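(* Let $(X(t))$ be an irreducible and transient Markov chain on a countable set $E$ with substochastic transition matrix $P=(p(x,y))_{x,y\in E}$. Assume that $E$ is a subset of a group $(\mathcal E,\star)$, that $(E,\star)$ is a semigroup containing the identity element $e$, and that $p(x\star u,y\star u)\ge p(x,y)$ for all $x,y,u\in E$. Suppose that the hitting probabilities of $(X(t))$ are slowly varying along every $u\in E$, i.e. for every $u\in E$, uniformly in $x\in E$, $$\lim_{n\to\infty}\frac1n\log Q(x,x\star u^{\star n})=\lim_{n\to\infty}\frac1n\log Q(x\star u^{\star n},x)=0 .$$ Let $(H_n)$ be the ladder height process relative to $(X(t))$, $\mathcal T_\vartheta=\inf\{n\ge0:H_n=\vartheta\}$ and $V(x)=\mathbb E_x(\mathcal T_\vartheta)$, $x\in E$. Then any harmonic function $h$ of $(X(t))$ is superharmonic for $(H_n)$ and $$h(x)=h(e)V(x)+\tilde h(x),\qquad\forall x\in E,$$ where $$\tilde h(x)=\lim_{n\to\infty}\mathbb E_x\bigl(h(H_n);\,\mathcal T_\vartheta>n\bigr),\qquad x\in E,$$ satisfies $P_H\tilde h=\tilde h$ (i.e. is harmonic, possibly zero, for $(H_n)$). If moreover $\mathbb E_x(\tau_\vartheta)=+\infty$ for all $x\in E$, then for any harmonic function $h$ of $(X(t))$ one has $\tilde h=0$ and $h$ is proportional to $V$. Otherwise, for any harmonic function $h$ of $(X(t))$, the function $\tilde h$ is non-trivial (not identically zero).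
   Context: Irreducible: for all $x,y\in E$ there is $n\ge1$ with $\mathbb P_x(X(n)=y)>0$. The chain is completed by an absorbing state $\vartheta\notin E$ with $p(x,\vartheta)=1-\sum_{y\in E}p(x,y)$, and $\tau_\vartheta=\inf\{t\ge1:X(t)=\vartheta\}$. By irreducibility $x\mapsto\mathbb E_x(\tau_\vartheta)$ is either finite everywhere or infinite everywhere on $E$. Green function: $G(x,y)=\sum_{t\ge0}\mathbb P_x(X(t)=y)$, $x,y\in E$; $G\varphi(x)=\sum_{y\in E}G(x,y)\varphi(y)$, $P\varphi(x)=\sum_{y\in E}p(x,y)\varphi(y)$ for $\varphi\ge0$. $Q(x,y)=\mathbb P_x(X(t)=y\text{ for some }0<t<+\infty)$; $u^{\star1}=u$, $u^{\star(n+1)}=u^{\star n}\star u$. A harmonic function of $(X(t))$ is a non-zero $h:E\to[0,\infty)$ with $Ph=h$. For $u\in E$, $A_u\varphi(x)=\sum_{y\in E}a_u(x,y)\varphi(y)$, where $a_u(x,y)=p(x\star u,y)-p(x,y\star u^{-1})$ if $y\in E\star u$ and $a_u(x,y)=p(x\star u,y)$ if $y\in E\setminus(E\star u)$; these coefficients are non-negative. The ladder height process $(H_n)$ is the Markov chain on $E\cup\{\vartheta\}$ with transition probabilities $p_H(x,y)=GA_x\mathbf 1_{\{y\}}(e)=\sum_{z\in E}G(e,z)a_x(z,y)$ for $x,y\in E$ (this matrix is substochastic), $p_H(x,\vartheta)=1-\sum_{y\in E}p_H(x,y)$, and $\vartheta$ absorbing. $P_H\varphi(x)=\sum_{y\in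 E}p_H(x,y)\varphi(y)=\mathbb E_x(\varphi(H_1);\mathcal T_\vartheta>1)$; superharmonic for $(H_n)$ means $P_Hh\le h$. *)

theory Defs
  imports "HOL-Probability.Probability" "HOL-Algebra.Coset"
begin

text \<open>
  Chains live on \<open>Some ` E \<union> {None}\<close>, with \<^term>\<open>None\<close> the absorbing cemetery state. Kernels, Green
  functions and expectations of nonnegative quantities take values in \<^typ>\<open>ennreal\<close>, so sums over
  the state space are integrals against \<^term>\<open>count_space E\<close> and need no convergence
  side conditions.
\<close>

definition substochastic :: "'a set \<Rightarrow> ('a \<Rightarrow> 'a \<Rightarrow> real) \<Rightarrow> bool" where
  "substochastic E p \<longleftrightarrow>
     (\<forall>x\<in>E. \<forall>y\<in>E. 0 \<le> p x y) \<and>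
     (\<forall>x\<in>E. (\<integral>\<^sup>+ y. ennreal (p x y) \<partial>count_space E) \<le> 1)"

definition completed_kernel ::
    "'a set \<Rightarrow> ('a \<Rightarrow> 'a \<Rightarrow> ennreal) \<Rightarrow> 'a option \<Rightarrow> 'a option \<Rightarrow> ennreal" where
  "completed_kernel E k s t =
     (case s of
        None \<Rightarrow> (if t = None then 1 else 0)
      | Some x \<Rightarrow> (case t of
            None \<Rightarrow> 1 - (\<integral>\<^sup>+ y. k x y \<partial>count_space E)
          | Some y \<Rightarrow> k x y))"

text \<open>
  \<open>M x\<close> is the law under which the chain \<open>X\<close> starts at \<open>x\<close>. For countable \<open>E\<close> the
  finite-dimensional distributions are determined by the probabilities of finite trajectories.
\<close>

definition markov_chain ::
    "'a set \<Rightarrow> ('a \<Rightarrow> 'a \<Rightarrow> ennreal) \<Rightarrow> ('a \<Rightarrow> 'w measure) \<Rightarrow> (nat \<Rightarrow> 'w \<Rightarrow> 'a option) \<Rightarrow> bool" where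
  "markov_chain E k M X \<longleftrightarrow>
     (\<forall>x\<in>E. prob_space (M x) \<and>
        (\<forall>t. X t \<in> M x \<rightarrow>\<^sub>M count_space (insert None (Some ` E))) \<and>
        (\<forall>n s. (\<forall>i\<le>n. s i \<in> insert None (Some ` E)) \<longrightarrow>
           emeasure (M x) {\<omega> \<in> space (M x). \<forall>i\<le>n. X i \<omega> = s i} =
             (if s 0 = Some x then \<Prod>i<n. completed_kernel E k (s i) (s (Suc i)) else 0)))"

definition irreducible_chain ::
    "'a set \<Rightarrow> ('a \<Rightarrow> 'w measure) \<Rightarrow> (nat \<Rightarrow> 'w \<Rightarrow> 'a option) \<Rightarrow> bool" where
  "irreducible_chain E M X \<longleftrightarrow>
     (\<forall>x\<in>E. \<forall>y\<in>E. \<exists>n\<ge>1. \<P>(\<omega> in M x. X n \<omega> = Some y) > 0)"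

definition hit_prob :: "('a \<Rightarrow> 'w measure) \<Rightarrow> (nat \<Rightarrow> 'w \<Rightarrow> 'a option) \<Rightarrow> 'a \<Rightarrow> 'a \<Rightarrow> real" where
  "hit_prob M X x y = \<P>(\<omega> in M x. \<exists>t>0. X t \<omega> = Some y)"

definition transient_chain ::
    "'a set \<Rightarrow> ('a \<Rightarrow> 'w measure) \<Rightarrow> (nat \<Rightarrow> 'w \<Rightarrow> 'a option) \<Rightarrow> bool" where
  "transient_chain E M X \<longleftrightarrow> (\<forall>x\<in>E. hit_prob M X x x < 1)"

definition green ::
    "('a \<Rightarrow> 'w measure) \<Rightarrow> (nat \<Rightarrow> 'w \<Rightarrow> 'a option) \<Rightarrow> 'a \<Rightarrow> 'a \<Rightarrow> ennreal" where
  "green M X x y = (\<Sum>t. emeasure (M x) {\<omega> \<in> space (M x). X t \<omega> = Some y})"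

text \<open>
  Irreducibility makes every hitting probability positive, so the value of \<^const>\<open>ln\<close> at 0
  plays no role below.
\<close>

definition slowly_varying_hitting ::
    "('a, 'b) monoid_scheme \<Rightarrow> 'a set \<Rightarrow> ('a \<Rightarrow> 'w measure) \<Rightarrow> (nat \<Rightarrow> 'w \<Rightarrow> 'a option) \<Rightarrow> bool" where
  "slowly_varying_hitting G E M X \<longleftrightarrow>
     (\<forall>u\<in>E.
        uniform_limit E (\<lambda>n x. ln (hit_prob M X x (x \<otimes>\<^bsub>G\<^esub> u [^]\<^bsub>G\<^esub> n)) / real n) (\<lambda>x. 0) sequentially \<and>
        uniform_limit E (\<lambda>n x. ln (hit_prob M X (x \<otimes>\<^bsub>G\<^esub> u [^]\<^bsub>G\<^esub> n) x) / real n) (\<lambda>x. 0) sequentially)"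

definition kernel_op :: "'a set \<Rightarrow> ('a \<Rightarrow> 'a \<Rightarrow> ennreal) \<Rightarrow> ('a \<Rightarrow> ennreal) \<Rightarrow> 'a \<Rightarrow> ennreal" where
  "kernel_op E k \<phi> x = (\<integral>\<^sup>+ y. k x y * \<phi> y \<partial>count_space E)"

definition harmonic_function :: "'a set \<Rightarrow> ('a \<Rightarrow> 'a \<Rightarrow> real) \<Rightarrow> ('a \<Rightarrow> real) \<Rightarrow> bool" where
  "harmonic_function E p h \<longleftrightarrow>
     (\<forall>x\<in>E. 0 \<le> h x) \<and> (\<exists>x\<in>E. h x \<noteq> 0) \<and>
     (\<forall>x\<in>E. kernel_op E (\<lambda>x y. ennreal (p x y)) (\<lambda>y. ennreal (h y)) x = ennreal (h x))"

definition ladder_coeff ::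
    "('a, 'b) monoid_scheme \<Rightarrow> 'a set \<Rightarrow> ('a \<Rightarrow> 'a \<Rightarrow> real) \<Rightarrow> 'a \<Rightarrow> 'a \<Rightarrow> 'a \<Rightarrow> real" where
  "ladder_coeff G E p u x y =
     (if y \<in> E #>\<^bsub>G\<^esub> u then p (x \<otimes>\<^bsub>G\<^esub> u) y - p x (y \<otimes>\<^bsub>G\<^esub> inv\<^bsub>G\<^esub> u) else p (x \<otimes>\<^bsub>G\<^esub> u) y)"

definition ladder_kernel ::
    "('a, 'b) monoid_scheme \<Rightarrow> 'a set \<Rightarrow> ('a \<Rightarrow> 'a \<Rightarrow> real) \<Rightarrow> ('a \<Rightarrow> 'w measure) \<Rightarrow>
      (nat \<Rightarrow> 'w \<Rightarrow> 'a option) \<Rightarrow> 'a \<Rightarrow> 'a \<Rightarrow> ennreal" where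
  "ladder_kernel G E p M X x y =
     (\<integral>\<^sup>+ z. green M X \<one>\<^bsub>G\<^esub> z * ennreal (ladder_coeff G E p x z y) \<partial>count_space E)"

text \<open>
  First time \<open>t \<ge> t\<^sub>0\<close> at which the chain sits in the cemetery; the infimum of the empty
  set in \<^typ>\<open>ennreal\<close> is \<open>\<infinity>\<close>.
\<close>

definition killing_time :: "nat \<Rightarrow> (nat \<Rightarrow> 'w \<Rightarrow> 'a option) \<Rightarrow> 'w \<Rightarrow> ennreal" where
  "killing_time t\<^sub>0 X \<omega> = (INF t\<in>{t. t\<^sub>0 \<le> t \<and> X t \<omega> = None}. of_nat t)"

definition expected_killing_time ::
    "nat \<Rightarrow> ('a \<Rightarrow> 'w measure) \<Rightarrow> (nat \<Rightarrow> 'w \<Rightarrow> 'a option) \<Rightarrow> 'a \<Rightarrow> ennreal" where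
  "expected_killing_time t\<^sub>0 M X x = (\<integral>\<^sup>+ \<omega>. killing_time t\<^sub>0 X \<omega> \<partial>M x)"

text \<open>
  \<open>\<E>\<^sub>x(h(H\<^sub>n); \<T> > n)\<close>, where \<open>\<T>\<close> is the first \<open>n \<ge> 0\<close> with \<open>H\<^sub>n\<close> in the cemetery. The value
  chosen for \<^term>\<open>None\<close> is irrelevant, since \<open>H\<^sub>n\<close> is in \<open>E\<close> on the event \<open>\<T> > n\<close>.
\<close>

definition surviving_mean ::
    "('a \<Rightarrow> 'v measure) \<Rightarrow> (nat \<Rightarrow> 'v \<Rightarrow> 'a option) \<Rightarrow> ('a \<Rightarrow> real) \<Rightarrow> 'a \<Rightarrow> nat \<Rightarrow> ennreal" where
  "surviving_mean N H h x n =
     (\<integral>\<^sup>+ \<omega>. (case H n \<omega> of Some y \<Rightarrow> ennreal (h y) | None \<Rightarrow> 0) *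
            indicator {\<omega>. of_nat n < killing_time 0 H \<omega>} \<omega> \<partial>N x)"

definition surviving_limit ::
    "('a \<Rightarrow> 'v measure) \<Rightarrow> (nat \<Rightarrow> 'v \<Rightarrow> 'a option) \<Rightarrow> ('a \<Rightarrow> real) \<Rightarrow> 'a \<Rightarrow> ennreal" where
  "surviving_limit N H h x = lim (surviving_mean N H h x)"

end

theory Submission
  imports Defs
begin

text \<open>
  Let \<open>T\<^sub>u f(x) = f(x \<star> u)\<close>. Since \<open>T\<^sub>u P = P T\<^sub>u + A\<^sub>u\<close>, a harmonic \<open>h\<close> has the Riesz decomposition
  \<open>T\<^sub>u h = G A\<^sub>u h + K\<^sub>u h\<close>, with \<open>K\<^sub>u h\<close> harmonic, and \<open>u \<mapsto> K\<^sub>u\<close> is multiplicative. By the Harnack inequality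
  \<open>h(x) \<ge> Q(x,y) h(y)\<close> and slow variation, \<open>K\<^sub>u\<^sup>n\<close> lies between \<open>e\<^sup>-\<^sup>\<epsilon>\<^sup>n\<close> and \<open>e\<^sup>\<epsilon>\<^sup>n\<close> times the identity. If
  \<open>a \<le> K\<^sub>u \<le> b\<close>, then \<open>(b - K\<^sub>u)\<^sup>2 \<ge> 0\<close> and \<open>(b - K\<^sub>u) (K\<^sub>u - a) \<ge> 0\<close>; these let one take square roots of the
  bounds on \<open>K\<^sub>u\<^sup>2\<close>, hence \<open>K\<^sub>u h = h\<close>. Evaluated at \<open>e\<close> this reads \<open>h = h(e) + P\<^sub>H h\<close>, and iterating gives the
  decomposition with \<open>V = \<Sum>n. P\<^sub>H\<^sup>n 1\<close>.

  If \<open>G 1 < \<infinity>\<close>, the same computation gives \<open>G 1 = G 1(e) + P\<^sub>H G 1\<close>, so \<open>V \<le> G 1 / G 1(e)\<close> and \<open>V\<close> is dominated by a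
  potential; hence no harmonic function is a multiple of \<open>V\<close>. If \<open>G 1 = \<infinity>\<close>, the identity for the kernels \<open>s p\<close>
  with \<open>s < 1\<close> yields \<open>V \<le> P V\<close> as \<open>s\<close> tends to 1; then the limit term is superharmonic and vanishes at \<open>e\<close>,
  so it vanishes everywhere by irreducibility.
\<close>

section \<open>Kernel operators and potentials\<close>

lemma kernel_op_mono:
  "(\<And>y. y \<in> E \<Longrightarrow> f y \<le> g y) \<Longrightarrow> kernel_op E k f x \<le> kernel_op E k g x"
  unfolding kernel_op_def by (intro nn_integral_mono mult_left_mono) auto

lemma kernel_op_cong:
  assumes "\<And>y. y \<in> E \<Longrightarrow> f y = g y" "\<And>y. y \<in> E \<Longrightarrow> k x y = l x y"
  shows "kernel_op E k f x = kernel_op E l g x"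
  unfolding kernel_op_def using assms by (intro nn_integral_cong) auto

lemma kernel_op_add: "kernel_op E k (\<lambda>y. f y + g y) x = kernel_op E k f x + kernel_op E k g x"
  unfolding kernel_op_def by (simp add: distrib_left nn_integral_add)

lemma kernel_op_cmult: "kernel_op E k (\<lambda>y. c * f y) x = c * kernel_op E k f x"
  unfolding kernel_op_def by (simp add: mult.left_commute nn_integral_cmult)

lemma kernel_op_ge_term: "y \<in> E \<Longrightarrow> k x y * f y \<le> kernel_op E k f x"
  unfolding kernel_op_def using nn_integral_ge_point[of y E "\<lambda>y. k x y * f y"] by simp

lemma kernel_op_suminf:
  "kernel_op E k (\<lambda>y. \<Sum>i. f i y) x = (\<Sum>i. kernel_op E k (f i) x)"
  unfolding kernel_op_def by (simp flip: nn_integral_suminf)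

text \<open>Monotone convergence from above needs a finite integral at the start of the sequence. It
  is what makes limits of decreasing iterates harmonic.\<close>

lemma kernel_op_INF:
  assumes dec: "\<And>n y. y \<in> E \<Longrightarrow> f (Suc n) y \<le> f n y" and fin: "kernel_op E k (f 0) x < \<infinity>"
  shows "kernel_op E k (\<lambda>y. INF n. f n y) x = (INF n. kernel_op E k (f n) x)"
proof -
  have le: "f n y \<le> f m y" if "y \<in> E" "m \<le> n" for y m n
    using that lift_Suc_antimono_le[of "\<lambda>n. f n y"] dec by blast
  \<comment> \<open>Monotonicity is known on \<open>E\<close> only; the cut-off makes the sequence
    decreasing everywhere without changing the integrals.\<close>
  define F where "F = (\<lambda>n y. k x y * (if y \<in> E then f n y else 0))"
  have decF: "decseq F"
    unfolding F_def by (intro decseq_SucI le_funI mult_left_mono) (auto simp: dec)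
  have fin0: "(\<integral>\<^sup>+ y. F 0 y \<partial>count_space E) < \<infinity>"
    using fin unfolding kernel_op_def F_def by (simp cong: nn_integral_cong_simp)
  have *: "(\<integral>\<^sup>+ y. (INF n. F n y) \<partial>count_space E) = (INF n. \<integral>\<^sup>+ y. F n y \<partial>count_space E)"
    using decF fin0 by (intro nn_integral_monotone_convergence_INF_decseq[where i = 0]) auto
  have fy: "k x y * f 0 y < \<infinity>" if "y \<in> E" for y
    using fin kernel_op_ge_term[OF that, of k x "f 0"] by (simp add: le_less_trans)
  have INFm: "(INF n. k x y * f n y) = k x y * (INF n. f n y)" if y: "y \<in> E" for y
  proof (cases "k x y = 0")
    case False
    note k0 = this
    have f0: "f 0 y < \<infinity>"
      using fy[OF y] k0 by (auto simp: ennreal_mult_less_top)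
    have d: "decseq (\<lambda>n. f n y)" using le[OF y] by (auto simp: decseq_def)
    have d2: "decseq (\<lambda>n. k x y * f n y)" using le[OF y] by (auto simp: decseq_def intro: mult_left_mono)
    show ?thesis
    proof (cases "k x y < \<infinity>")
      case True
      have "(\<lambda>n. k x y * f n y) \<longlonglongrightarrow> k x y * (INF n. f n y)"
        using LIMSEQ_INF[OF d] True by (intro ennreal_tendsto_cmult) auto
      then show ?thesis using LIMSEQ_INF[OF d2] LIMSEQ_unique by blast
    next
      \<comment> \<open>An infinite weight \<open>k x y\<close> is possible, but then finiteness of
        \<open>k x y * f 0 y\<close> forces \<open>f 0 y = 0\<close>, and all later terms vanish as
        well.\<close>
      case False
      then have "f 0 y = 0" using fy[OF y] by (auto simp: ennreal_mult_less_top less_top)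
      then have "f n y = 0" for n using le[OF y, of 0 n] by simp
      then show ?thesis by simp
    qed
  qed simp
  show ?thesis
    using * unfolding kernel_op_def F_def by (simp add: INFm cong: nn_integral_cong_simp)
qed

lemma kernel_op_SUP:
  assumes "\<And>i y. y \<in> E \<Longrightarrow> f i y \<le> f (Suc i) y"
  shows "kernel_op E k (\<lambda>y. SUP i. f i y) x = (SUP i. kernel_op E k (f i) x)"
proof -
  have le: "f m y \<le> f n y" if "y \<in> E" "m \<le> n" for y m n
    using that lift_Suc_mono_le[of "\<lambda>n. f n y"] assms by blast
  define F where "F = (\<lambda>n y. k x y * (if y \<in> E then f n y else 0))"
  have incF: "incseq F"
    by (auto simp: F_def incseq_def le_fun_def intro!: mult_left_mono le)
  have "(\<integral>\<^sup>+ y. (SUP n. F n y) \<partial>count_space E) = (SUP n. \<integral>\<^sup>+ y. F n y \<partial>count_space E)"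
    using incF by (intro nn_integral_monotone_convergence_SUP) auto
  then show ?thesis
    unfolding kernel_op_def F_def
    by (simp add: SUP_mult_left_ennreal cong: nn_integral_cong_simp)
qed

section \<open>Powers of a kernel operator\<close>

lemma kernel_pow_mono:
  assumes "\<And>y. y \<in> E \<Longrightarrow> f y \<le> g y" "x \<in> E"
  shows "(kernel_op E k ^^ n) f x \<le> (kernel_op E k ^^ n) g x"
  using assms(2) by (induction n arbitrary: x) (auto intro: assms(1) kernel_op_mono)

lemma kernel_pow_cong:
  assumes "\<And>y. y \<in> E \<Longrightarrow> f y = g y" "x \<in> E"
  shows "(kernel_op E k ^^ n) f x = (kernel_op E k ^^ n) g x"
  using assms by (intro antisym kernel_pow_mono) auto

lemma kernel_pow_add:
  "(kernel_op E k ^^ n) (\<lambda>y. f y + g y) = (\<lambda>x. (kernel_op E k ^^ n) f x + (kernel_op E k ^^ n) g x)"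
proof (induction n)
  case (Suc n)
  show ?case by (rule ext) (simp add: Suc kernel_op_add)
qed simp

lemma kernel_pow_cmult:
  "(kernel_op E k ^^ n) (\<lambda>y. c * f y) = (\<lambda>x. c * (kernel_op E k ^^ n) f x)"
proof (induction n)
  case (Suc n)
  show ?case by (rule ext) (simp add: Suc kernel_op_cmult)
qed simp

lemma kernel_pow_Suc': "(kernel_op E k ^^ n) (kernel_op E k f) = (kernel_op E k ^^ Suc n) f"
  by (simp add: funpow_swap1)

lemma kernel_pow_decseq:
  assumes "\<And>y. y \<in> E \<Longrightarrow> kernel_op E k f y \<le> f y" "x \<in> E"
  shows "decseq (\<lambda>n. (kernel_op E k ^^ n) f x)"
proof (rule decseq_SucI)
  fix n show "(kernel_op E k ^^ Suc n) f x \<le> (kernel_op E k ^^ n) f x"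
    unfolding kernel_pow_Suc'[symmetric] using assms by (rule kernel_pow_mono)
qed

lemma kernel_pow_le:
  assumes "\<And>y. y \<in> E \<Longrightarrow> kernel_op E k f y \<le> f y" "x \<in> E"
  shows "(kernel_op E k ^^ n) f x \<le> f x"
  using decseqD[OF kernel_pow_decseq[OF assms], of 0 n] by simp

lemma kernel_pow_harmonic:
  assumes "\<And>y. y \<in> E \<Longrightarrow> kernel_op E k f y = f y" "x \<in> E"
  shows "(kernel_op E k ^^ n) f x = f x"
  using assms(2) by (induction n arbitrary: x) (auto simp: assms(1) cong: kernel_op_cong)

text \<open>Unrolls the inequality n times. The remainder is kept, so nothing has to be subtracted
  in \<open>ennreal\<close> and both directions combine to the equation in
  \<open>kernel_iterate\<close>.\<close>

lemma kernel_iterate_le: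
  assumes "\<And>y. y \<in> E \<Longrightarrow> g y \<le> \<psi> y + kernel_op E k g y" "x \<in> E"
  shows "g x \<le> (\<Sum>t<n. (kernel_op E k ^^ t) \<psi> x) + (kernel_op E k ^^ n) g x"
proof (induction n)
  case (Suc n)
  have "(kernel_op E k ^^ n) g x \<le> (kernel_op E k ^^ n) (\<lambda>y. \<psi> y + kernel_op E k g y) x"
    using assms by (rule kernel_pow_mono)
  also have "\<dots> = (kernel_op E k ^^ n) \<psi> x + (kernel_op E k ^^ Suc n) g x"
    by (simp only: kernel_pow_add kernel_pow_Suc')
  finally show ?case
    using Suc by (auto simp: add.assoc intro: order_trans add_left_mono)
qed simp

lemma kernel_iterate_ge:
  assumes "\<And>y. y \<in> E \<Longrightarrow> \<psi> y + kernel_op E k g y \<le> g y" "x \<in> E"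
  shows "(\<Sum>t<n. (kernel_op E k ^^ t) \<psi> x) + (kernel_op E k ^^ n) g x \<le> g x"
proof (induction n)
  case (Suc n)
  have "(kernel_op E k ^^ n) \<psi> x + (kernel_op E k ^^ Suc n) g x
      = (kernel_op E k ^^ n) (\<lambda>y. \<psi> y + kernel_op E k g y) x"
    by (simp only: kernel_pow_add kernel_pow_Suc')
  also have "\<dots> \<le> (kernel_op E k ^^ n) g x"
    using assms by (rule kernel_pow_mono)
  finally show ?case
    using Suc by (auto simp: add.assoc intro: order_trans add_left_mono)
qed simp

lemma kernel_iterate:
  assumes "\<And>y. y \<in> E \<Longrightarrow> g y = \<psi> y + kernel_op E k g y" "x \<in> E"
  shows "g x = (\<Sum>t<n. (kernel_op E k ^^ t) \<psi> x) + (kernel_op E k ^^ n) g x"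
  using assms by (intro antisym kernel_iterate_le kernel_iterate_ge) auto

section \<open>Potentials (the Green operator of a kernel)\<close>

definition potential :: "'a set \<Rightarrow> ('a \<Rightarrow> 'a \<Rightarrow> ennreal) \<Rightarrow> ('a \<Rightarrow> ennreal) \<Rightarrow> 'a \<Rightarrow> ennreal" where
  "potential E k f x = (\<Sum>t. (kernel_op E k ^^ t) f x)"

lemma LIMSEQ_potential: "(\<lambda>n. \<Sum>t<n. (kernel_op E k ^^ t) f x) \<longlonglongrightarrow> potential E k f x"
  unfolding potential_def by (rule summable_LIMSEQ) simp

lemma potential_cmult: "potential E k (\<lambda>y. c * f y) x = c * potential E k f x"
  unfolding potential_def by (simp add: kernel_pow_cmult)

text \<open>Minimality: every supersolution of g = \<psi> + k g dominates the partial sums of the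
  series. This is the main comparison principle below.\<close>

lemma potential_le:
  assumes "\<And>y. y \<in> E \<Longrightarrow> \<psi> y + kernel_op E k g y \<le> g y" "x \<in> E"
  shows "potential E k \<psi> x \<le> g x"
proof -
  have "(\<Sum>t<n. (kernel_op E k ^^ t) \<psi> x) \<le> g x" for n
    using kernel_iterate_ge[of E \<psi> k g x n, OF assms] by (meson le_iff_add order_trans)
  then show ?thesis
    unfolding potential_def suminf_eq_SUP by (intro SUP_least) 
qed

lemma potential_eq: "potential E k f x = f x + kernel_op E k (potential E k f) x"
proof -
  have "(\<Sum>t. (kernel_op E k ^^ t) f x) = f x + (\<Sum>t. (kernel_op E k ^^ Suc t) f x)"
    using suminf_offset[of "\<lambda>t. (kernel_op E k ^^ t) f x" 1] by simp
  then show ?thesis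
    unfolding potential_def[abs_def] by (simp add: kernel_op_suminf)
qed

text \<open>The n-th iterate of a potential is the tail of its defining series from index n on, and
  the series converges to a finite value.\<close>

lemma kernel_pow_potential_tendsto_0:
  assumes "potential E k f x < \<infinity>"
  shows "(\<lambda>n. (kernel_op E k ^^ n) (potential E k f) x) \<longlonglongrightarrow> 0"
proof -
  have *: "(kernel_op E k ^^ n) (potential E k f) = (\<lambda>x. \<Sum>t. (kernel_op E k ^^ (t + n)) f x)" for n
  proof (induction n)
    case (Suc n)
    show ?case by (rule ext) (simp add: Suc kernel_op_suminf)
  qed (simp add: potential_def fun_eq_iff)
  let ?S = "\<lambda>n. \<Sum>t<n. (kernel_op E k ^^ t) f x"
  have split: "potential E k f x = (\<Sum>t. (kernel_op E k ^^ (t + n)) f x) + ?S n" for n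
    unfolding potential_def by (rule suminf_offset) simp
  have "(\<Sum>t. (kernel_op E k ^^ (t + n)) f x) = potential E k f x - ?S n" for n
    using split[of n] assms by (simp add: ennreal_add_diff_cancel_right less_top)
  moreover have "(\<lambda>n. potential E k f x - ?S n) \<longlonglongrightarrow> potential E k f x - potential E k f x"
    using assms by (intro tendsto_diff_ennreal tendsto_const LIMSEQ_potential) auto
  ultimately show ?thesis
    using assms by (simp add: *)
qed

section \<open>Shifts and harmonic parts\<close>

text \<open>Iterates are operators, so the matrix entry of the t-th power at (x, z) appears as the
  iterate applied to \<open>indicator {z}\<close>. The interchange of sums uses countability of
  \<open>E\<close>.\<close>

lemma kernel_pow_point:
  assumes "countable E" "x \<in> E"
  shows "(kernel_op E k ^^ t) f x =
    (\<integral>\<^sup>+ z. (kernel_op E k ^^ t) (indicator {z}) x * f z \<partial>count_space E)"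
  using assms(2)
proof (induction t arbitrary: x)
  case 0
  have "(\<integral>\<^sup>+ z. indicator {z} x * f z \<partial>count_space E) = (\<Sum>z\<in>{x}. indicator {z} x * f z)"
    using 0 by (intro nn_integral_count_space') auto
  then show ?case by simp
next
  case (Suc t)
  let ?g = "\<lambda>y z. (kernel_op E k ^^ t) (indicator {z}) y"
  have "(kernel_op E k ^^ Suc t) f x = (\<integral>\<^sup>+ y. (\<integral>\<^sup>+ z. k x y * (?g y z * f z) \<partial>count_space E) \<partial>count_space E)"
    by (simp add: kernel_op_def[of E k _ x] nn_integral_cmult Suc.IH cong: nn_integral_cong_simp)
  also have "\<dots> = (\<integral>\<^sup>+ z. (\<integral>\<^sup>+ y. k x y * (?g y z * f z) \<partial>count_space E) \<partial>count_space E)"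
    using assms(1) by (intro nn_integral_count_space_nn_integral) auto
  also have "\<dots> = (\<integral>\<^sup>+ z. (kernel_op E k ^^ Suc t) (indicator {z}) x * f z \<partial>count_space E)"
    by (simp add: kernel_op_def[of E k _ x] nn_integral_multc mult.assoc[symmetric])
  finally show ?case .
qed

lemma potential_point:
  assumes "countable E" "x \<in> E"
  shows "potential E k f x = (\<integral>\<^sup>+ z. potential E k (indicator {z}) x * f z \<partial>count_space E)"
  unfolding potential_def kernel_pow_point[OF assms, where f = f and k = k]
  by (simp add: nn_integral_suminf[symmetric] ennreal_suminf_multc)

section \<open>Shifts on the semigroup and their commutation with the kernel\<close>

text \<open>Only the algebraic data enter, without any process, so that the locale can also be
  instantiated at the kernels s p with s <= 1.\<close>

locale semigroup_kernel = group G for G (structure) +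
  fixes E :: "'a set" and p :: "'a \<Rightarrow> 'a \<Rightarrow> real"
  assumes submonoid: "submonoid E G"
    and substochastic: "substochastic E p"
    and shift_increasing: "\<lbrakk>x \<in> E; y \<in> E; u \<in> E\<rbrakk> \<Longrightarrow> p x y \<le> p (x \<otimes> u) (y \<otimes> u)"
begin

lemma E_carrier: "x \<in> E \<Longrightarrow> x \<in> carrier G"
  using submonoid.subset[OF submonoid] by auto

lemma E_closed [simp, intro]: "x \<in> E \<Longrightarrow> y \<in> E \<Longrightarrow> x \<otimes> y \<in> E"
  using submonoid.m_closed[OF submonoid] .

lemma E_one [simp, intro]: "\<one> \<in> E"
  using submonoid.one_closed[OF submonoid] .

lemma E_pow [simp, intro]: "x \<in> E \<Longrightarrow> x [^] (n::nat) \<in> E"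
  by (induction n) auto

abbreviation "k \<equiv> \<lambda>x y. ennreal (p x y)"
abbreviation "P \<equiv> kernel_op E k"

definition shift :: "'a \<Rightarrow> ('a \<Rightarrow> ennreal) \<Rightarrow> 'a \<Rightarrow> ennreal" where
  "shift u f x = f (x \<otimes> u)"

definition defect :: "'a \<Rightarrow> ('a \<Rightarrow> ennreal) \<Rightarrow> 'a \<Rightarrow> ennreal" where
  "defect u = kernel_op E (\<lambda>x y. ennreal (ladder_coeff G E p u x y))"

lemma p_nonneg: "x \<in> E \<Longrightarrow> y \<in> E \<Longrightarrow> 0 \<le> p x y"
  using substochastic by (auto simp: substochastic_def)

lemma P_one_le: "x \<in> E \<Longrightarrow> P (\<lambda>_. 1) x \<le> 1"
  using substochastic by (auto simp: substochastic_def kernel_op_def)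

lemma bij_shift: "u \<in> E \<Longrightarrow> bij_betw (\<lambda>w. w \<otimes> u) E (E #> u)"
  by (auto simp: bij_betw_def r_coset_def inj_on_def E_carrier)

text \<open>The commutation rule T_u P = P T_u + A_u, with \<open>defect u\<close> as A_u. Row x u
  of \<open>p\<close> splits into the row of x transported by right translation and the coefficients
  of A_u, which \<open>shift_increasing\<close> makes non-negative.\<close>

lemma P_shift:
  assumes u: "u \<in> E" and x: "x \<in> E"
  shows "P f (x \<otimes> u) = P (shift u f) x + defect u f x"
proof -
  let ?I = "indicator (E #> u) :: 'a \<Rightarrow> ennreal"
  have sub: "E #> u \<subseteq> E" using u by (auto simp: r_coset_def)
  have canc: "w \<otimes> u \<otimes> inv u = w" if "w \<in> E" for w
    using that u by (simp add: E_carrier inv_solve_right')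
  \<comment> \<open>The difference in \<open>ladder_coeff\<close> is rewritten as a sum, since
    \<open>ennreal\<close> subtraction would truncate.\<close>
  have pt: "k (x \<otimes> u) y = k x (y \<otimes> inv u) * ?I y + ennreal (ladder_coeff G E p u x y)"
    if y: "y \<in> E" for y
  proof (cases "y \<in> E #> u")
    case True
    then obtain w where w: "w \<in> E" "y = w \<otimes> u" by (auto simp: r_coset_def)
    have "p x w \<le> p (x \<otimes> u) y" "0 \<le> p x w"
      using shift_increasing[OF x w(1) u] w p_nonneg[OF x w(1)] by auto
    then show ?thesis using True w canc by (simp add: ladder_coeff_def flip: ennreal_plus)
  qed (simp add: ladder_coeff_def)
  have "P f (x \<otimes> u) = (\<integral>\<^sup>+ y. k x (y \<otimes> inv u) * f y * ?I y + ennreal (ladder_coeff G E p u x y) * f y \<partial>count_space E)"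
    unfolding kernel_op_def by (intro nn_integral_cong) (simp add: pt distrib_left distrib_right mult_ac)
  also have "\<dots> = (\<integral>\<^sup>+ y. k x (y \<otimes> inv u) * f y * ?I y \<partial>count_space E) + defect u f x"
    by (simp add: nn_integral_add defect_def kernel_op_def)
  \<comment> \<open>The sum lives on the translate of \<open>E\<close> by u and is reindexed by y =
    w u.\<close>
  also have "(\<integral>\<^sup>+ y. k x (y \<otimes> inv u) * f y * ?I y \<partial>count_space E)
      = (\<integral>\<^sup>+ y. k x (y \<otimes> inv u) * f y * ?I y \<partial>count_space (E #> u))"
    by (rule nn_integral_count_space_eq) (use sub in auto)
  also have "\<dots> = (\<integral>\<^sup>+ y. k x (y \<otimes> inv u) * f y \<partial>count_space (E #> u))"
    by (intro nn_integral_cong) simp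
  also have "\<dots> = (\<integral>\<^sup>+ w. k x (w \<otimes> u \<otimes> inv u) * f (w \<otimes> u) \<partial>count_space E)"
    by (rule nn_integral_bij_count_space[OF bij_shift[OF u], symmetric])
  also have "\<dots> = P (shift u f) x"
    unfolding kernel_op_def shift_def by (intro nn_integral_cong) (simp add: canc)
  finally show ?thesis .
qed

text \<open>Dropping the non-negative term A_u from the commutation rule gives P T_u <= T_u P, which
  is iterated here.\<close>

lemma P_pow_shift_le:
  assumes "u \<in> E" "x \<in> E"
  shows "(P ^^ n) (shift u f) x \<le> (P ^^ n) f (x \<otimes> u)"
  using assms(2)
proof (induction n arbitrary: x)
  case (Suc n)
  have "P ((P ^^ n) (shift u f)) x \<le> P (shift u ((P ^^ n) f)) x"
    by (intro kernel_op_mono) (simp add: shift_def[of u "(P ^^ n) f"] Suc.IH)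
  also have "\<dots> \<le> P ((P ^^ n) f) (x \<otimes> u)"
    using P_shift[OF assms(1) Suc.prems, of "(P ^^ n) f"] by simp
  finally show ?case by simp
qed (simp add: shift_def)

text \<open>The ladder kernel with the Green function expressed through powers of the kernel, hence
  free of any probability space. The final proof identifies it with
  \<open>ladder_kernel\<close>.\<close>

definition ladder :: "'a \<Rightarrow> 'a \<Rightarrow> ennreal" where
  "ladder u y = (\<integral>\<^sup>+ z. potential E k (indicator {z}) \<one> * ennreal (ladder_coeff G E p u z y) \<partial>count_space E)"

lemma ladder_op_eq:
  assumes "countable E"
  shows "kernel_op E ladder f u = potential E k (defect u f) \<one>"
proof -
  let ?c = "\<lambda>z y. potential E k (indicator {z}) \<one> * ennreal (ladder_coeff G E p u z y) * f y"
  have "kernel_op E ladder f u = (\<integral>\<^sup>+ y. (\<integral>\<^sup>+ z. ?c z y \<partial>count_space E) \<partial>count_space E)"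
    unfolding kernel_op_def ladder_def by (simp add: nn_integral_multc)
  also have "\<dots> = (\<integral>\<^sup>+ z. (\<integral>\<^sup>+ y. ?c z y \<partial>count_space E) \<partial>count_space E)"
    using assms by (intro nn_integral_count_space_nn_integral) auto
  also have "\<dots> = potential E k (defect u f) \<one>"
    unfolding potential_point[OF assms E_one, of k "defect u f"]
    by (simp add: defect_def kernel_op_def nn_integral_cmult mult.assoc)
  finally show ?thesis .
qed

section \<open>Harmonic functions and the Riesz decomposition of their shifts\<close>

definition harmonic :: "('a \<Rightarrow> ennreal) \<Rightarrow> bool" where
  "harmonic f \<longleftrightarrow> (\<forall>x\<in>E. P f x = f x \<and> f x < \<infinity>)"

lemma harmonicD: "harmonic f \<Longrightarrow> x \<in> E \<Longrightarrow> P f x = f x" "harmonic f \<Longrightarrow> x \<in> E \<Longrightarrow> f x < \<infinity>"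
  by (auto simp: harmonic_def)

lemma harmonic_diff:
  assumes f: "harmonic f" and g: "harmonic g" and le: "\<And>x. x \<in> E \<Longrightarrow> g x \<le> f x"
  shows "harmonic (\<lambda>x. f x - g x)"
  unfolding harmonic_def
proof safe
  fix x assume x: "x \<in> E"
  have "P (\<lambda>x. f x - g x) x + P g x = P (\<lambda>y. (f y - g y) + g y) x"
    by (simp add: kernel_op_add)
  also have "\<dots> = P f x"
    by (rule kernel_op_cong) (auto simp: le diff_add_cancel_ennreal)
  finally have "P (\<lambda>x. f x - g x) x + g x = f x"
    using x f g by (simp add: harmonicD)
  then show "P (\<lambda>x. f x - g x) x = f x - g x"
    using harmonicD(2)[OF g x] by (metis ennreal_add_diff_cancel_right infinity_ennreal_def less_irrefl)
  show "f x - g x < \<infinity>"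
    using harmonicD(2)[OF f x] by (simp add: diff_less_top_ennreal)
qed

lemma harmonic_cmult: "harmonic f \<Longrightarrow> c < \<infinity> \<Longrightarrow> harmonic (\<lambda>x. c * f x)"
  by (auto simp: harmonic_def kernel_op_cmult ennreal_mult_less_top)

text \<open>The operator K_u. For harmonic f the sequence decreases, so the infimum is its limit,
  the largest harmonic minorant of T_u f.\<close>

definition harmonic_part :: "'a \<Rightarrow> ('a \<Rightarrow> ennreal) \<Rightarrow> 'a \<Rightarrow> ennreal" where
  "harmonic_part u f x = (INF n. (P ^^ n) (shift u f) x)"

lemma shift_superharmonic:
  assumes "harmonic f" "u \<in> E" "x \<in> E"
  shows "P (shift u f) x \<le> shift u f x"
  using P_shift[OF assms(2,3), of f] harmonicD(1)[OF assms(1), of "x \<otimes> u"] assms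
  by (auto simp: shift_def le_iff_add)

lemma harmonic_part_tendsto:
  assumes "harmonic f" "u \<in> E" "x \<in> E"
  shows "(\<lambda>n. (P ^^ n) (shift u f) x) \<longlonglongrightarrow> harmonic_part u f x"
  unfolding harmonic_part_def
  using assms by (intro LIMSEQ_INF kernel_pow_decseq) (auto intro: shift_superharmonic)

lemma harmonic_part_unique:
  assumes "harmonic f" "u \<in> E" "x \<in> E" "(\<lambda>n. (P ^^ n) (shift u f) x) \<longlonglongrightarrow> l"
  shows "harmonic_part u f x = l"
  using LIMSEQ_unique[OF harmonic_part_tendsto[OF assms(1-3)] assms(4)] .

lemma harmonic_part_le: "harmonic_part u f x \<le> f (x \<otimes> u)"
  unfolding harmonic_part_def by (rule INF_lower2[of 0]) (auto simp: shift_def)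

text \<open>P may be taken inside the decreasing limit by \<open>kernel_op_INF\<close>, where it
  only advances the index by one.\<close>

lemma harmonic_part_harmonic:
  assumes f: "harmonic f" and u: "u \<in> E"
  shows "harmonic (harmonic_part u f)"
  unfolding harmonic_def
proof safe
  fix x assume x: "x \<in> E"
  have "P (harmonic_part u f) x = (INF n. P ((P ^^ n) (shift u f)) x)"
    unfolding harmonic_part_def[abs_def]
  proof (rule kernel_op_INF)
    fix n y assume "y \<in> E"
    then show "(P ^^ Suc n) (shift u f) y \<le> (P ^^ n) (shift u f) y"
      using kernel_pow_decseq[of E k "shift u f" y] shift_superharmonic[OF f u]
      by (metis decseq_SucD)
  next
    have "P (shift u f) x \<le> f (x \<otimes> u)"
      using shift_superharmonic[OF f u x] by (simp add: shift_def)
    also have "\<dots> < \<infinity>" using harmonicD(2)[OF f] u x by auto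
    finally show "P ((P ^^ 0) (shift u f)) x < \<infinity>" by simp
  qed
  moreover have "(\<lambda>n. P ((P ^^ n) (shift u f)) x) \<longlonglongrightarrow> harmonic_part u f x"
    using LIMSEQ_Suc[OF harmonic_part_tendsto[OF f u x]] by simp
  moreover have "decseq (\<lambda>n. P ((P ^^ n) (shift u f)) x)"
    using kernel_pow_decseq[of E k "shift u f" x] shift_superharmonic[OF f u] x
    by (force simp: decseq_def dest: spec[of _ "Suc _"])
  ultimately show "P (harmonic_part u f) x = harmonic_part u f x"
    using LIMSEQ_INF LIMSEQ_unique by metis
  show "harmonic_part u f x < \<infinity>"
    using harmonic_part_le[of u f x] harmonicD(2)[OF f, of "x \<otimes> u"] u x by (auto intro: le_less_trans)
qed

lemma riesz_shift:
  assumes f: "harmonic f" and u: "u \<in> E" and x: "x \<in> E"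
  shows "f (x \<otimes> u) = potential E k (defect u f) x + harmonic_part u f x"
proof -
  have *: "shift u f y = defect u f y + P (shift u f) y" if "y \<in> E" for y
    using P_shift[OF u that, of f] harmonicD(1)[OF f, of "y \<otimes> u"] u that
    by (simp add: shift_def add.commute)
  \<comment> \<open>Every term of this sequence equals \<open>shift u f x\<close>, because T_u f =
    A_u f + P T_u f has been unrolled n times; the limit is therefore that value.\<close>
  have "(\<lambda>n. (\<Sum>t<n. (P ^^ t) (defect u f) x) + (P ^^ n) (shift u f) x)
      \<longlonglongrightarrow> potential E k (defect u f) x + harmonic_part u f x"
    by (intro tendsto_add LIMSEQ_potential harmonic_part_tendsto f u x)
  then show ?thesis
    using kernel_iterate[of E "shift u f" "defect u f" k x, OF * x]
    by (simp add: shift_def[of u f x] LIMSEQ_const_iff flip: kernel_iterate[of E "shift u f" "defect u f" k x, OF * x])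
qed

lemma harmonic_part_cong:
  assumes "\<And>y. y \<in> E \<Longrightarrow> f y = g y" "u \<in> E" "x \<in> E"
  shows "harmonic_part u f x = harmonic_part u g x"
proof -
  have "(P ^^ n) (shift u f) x = (P ^^ n) (shift u g) x" for n
    using assms by (intro kernel_pow_cong) (auto simp: shift_def)
  then show ?thesis by (simp add: harmonic_part_def)
qed

text \<open>Infima are not additive in general, so the proof goes through the limits that they
  represent.\<close>

lemma harmonic_part_add:
  assumes "harmonic f" "harmonic g" "harmonic (\<lambda>y. f y + g y)" "u \<in> E" "x \<in> E"
  shows "harmonic_part u (\<lambda>y. f y + g y) x = harmonic_part u f x + harmonic_part u g x"
proof (rule harmonic_part_unique[OF assms(3-5)])
  show "(\<lambda>n. (P ^^ n) (shift u (\<lambda>y. f y + g y)) x) \<longlonglongrightarrow> harmonic_part u f x + harmonic_part u g x"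
    unfolding shift_def kernel_pow_add
    by (intro tendsto_add harmonic_part_tendsto[unfolded shift_def] assms)
qed

lemma harmonic_part_cmult:
  assumes "harmonic f" "c < \<infinity>" "u \<in> E" "x \<in> E"
  shows "harmonic_part u (\<lambda>y. c * f y) x = c * harmonic_part u f x"
proof (rule harmonic_part_unique[OF harmonic_cmult[OF assms(1,2)] assms(3,4)])
  show "(\<lambda>n. (P ^^ n) (shift u (\<lambda>y. c * f y)) x) \<longlonglongrightarrow> c * harmonic_part u f x"
    unfolding shift_def kernel_pow_cmult using assms
    by (intro ennreal_tendsto_cmult harmonic_part_tendsto[unfolded shift_def]) auto
qed

text \<open>\<open>P\<^sup>n T\<^sub>u \<le> T\<^sub>u P\<^sup>n\<close> makes the potential part of \<open>T\<^sub>v f\<close> die out after a further shift by \<open>u\<close>.\<close>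

lemma harmonic_part_mult:
  assumes f: "harmonic f" and u: "u \<in> E" and v: "v \<in> E" and x: "x \<in> E"
  shows "harmonic_part (u \<otimes> v) f x = harmonic_part u (harmonic_part v f) x"
proof (rule harmonic_part_unique[OF f _ x])
  let ?U = "potential E k (defect v f)"
  have Ufin: "?U y < \<infinity>" if "y \<in> E" for y
    using riesz_shift[OF f v that] harmonicD(2)[OF f, of "y \<otimes> v"] v that by simp
  have eq: "(P ^^ n) (shift (u \<otimes> v) f) x = (P ^^ n) (shift u ?U) x + (P ^^ n) (shift u (harmonic_part v f)) x" for n
  proof -
    have "(P ^^ n) (shift (u \<otimes> v) f) x = (P ^^ n) (\<lambda>y. shift u ?U y + shift u (harmonic_part v f) y) x"
    proof (rule kernel_pow_cong[OF _ x])
      fix y assume y: "y \<in> E"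
      \<comment> \<open>Hence T_{u v} f at y is T_v f at y u, and the Riesz decomposition for v
        applies at the shifted point.\<close>
      have "y \<otimes> (u \<otimes> v) = (y \<otimes> u) \<otimes> v" using y u v by (simp add: m_assoc E_carrier)
      then show "shift (u \<otimes> v) f y = shift u ?U y + shift u (harmonic_part v f) y"
        using riesz_shift[OF f v, of "y \<otimes> u"] y u by (simp add: shift_def)
    qed
    then show ?thesis by (simp add: kernel_pow_add)
  qed
  have lim: "(\<lambda>n. (P ^^ n) ?U (x \<otimes> u)) \<longlonglongrightarrow> 0"
    using Ufin u x by (intro kernel_pow_potential_tendsto_0) auto
  have "(\<lambda>n. (P ^^ n) (shift u ?U) x) \<longlonglongrightarrow> 0"
    by (rule tendsto_sandwich[OF _ _ tendsto_const lim]) (auto intro!: always_eventually P_pow_shift_le u x)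
  then show "(\<lambda>n. (P ^^ n) (shift (u \<otimes> v) f) x) \<longlonglongrightarrow> harmonic_part u (harmonic_part v f) x"
    unfolding eq using tendsto_add[OF _ harmonic_part_tendsto[OF harmonic_part_harmonic[OF f v] u x]]
    by fastforce
qed (use u v in auto)

end

section \<open>Rigidity of the harmonic part\<close>

context semigroup_kernel
begin

lemma harmonic_add: "harmonic f \<Longrightarrow> harmonic g \<Longrightarrow> harmonic (\<lambda>x. f x + g x)"
  by (auto simp: harmonic_def kernel_op_add)

section \<open>Order bounds a <= K_u <= b and their square roots\<close>

text \<open>The bound is required of all harmonic functions at once, since it will be applied to
  auxiliary ones such as b f - K_u f.\<close>

definition upper :: "'a \<Rightarrow> real \<Rightarrow> bool" where
  "upper u b \<longleftrightarrow> (\<forall>f x. harmonic f \<longrightarrow> x \<in> E \<longrightarrow> harmonic_part u f x \<le> ennreal b * f x)"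

definition lower :: "'a \<Rightarrow> real \<Rightarrow> bool" where
  "lower u a \<longleftrightarrow> (\<forall>f x. harmonic f \<longrightarrow> x \<in> E \<longrightarrow> ennreal a * f x \<le> harmonic_part u f x)"

lemma upperD: "upper u b \<Longrightarrow> harmonic f \<Longrightarrow> x \<in> E \<Longrightarrow> harmonic_part u f x \<le> ennreal b * f x"
  by (simp add: upper_def)

lemma lowerD: "lower u a \<Longrightarrow> harmonic f \<Longrightarrow> x \<in> E \<Longrightarrow> ennreal a * f x \<le> harmonic_part u f x"
  by (simp add: lower_def)

text \<open>Passing to real values lets the pointwise inequalities below be settled by real
  arithmetic.\<close>

lemma harmonic_real:
  assumes "harmonic f" "x \<in> E"
  obtains r where "0 \<le> r" "f x = ennreal r"
  using harmonicD(2)[OF assms] by (cases "f x") auto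

text \<open>With d = b f - K f harmonic, K d <= b d says 2 b K f <= b^2 f + K^2 f, and K^2 is
  bounded by c^2. The new constant is Heron's step from b towards the square root c.\<close>

lemma upper_step:
  assumes u: "u \<in> E" and b: "0 < b" and c: "0 \<le> c"
    and ub: "upper u b" and uuc: "upper (u \<otimes> u) (c\<^sup>2)"
  shows "upper u ((b\<^sup>2 + c\<^sup>2) / (2 * b))"
  unfolding upper_def
proof safe
  fix f x assume f: "harmonic f" and x: "x \<in> E"
  let ?K = "harmonic_part u"
  define d where "d = (\<lambda>y. ennreal b * f y - ?K f y)"
  have Kf: "harmonic (?K f)" using f u by (rule harmonic_part_harmonic)
  have le: "?K f y \<le> ennreal b * f y" if "y \<in> E" for y using ub f that by (auto simp: upper_def)
  have d: "harmonic d" unfolding d_def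
    using f Kf le by (intro harmonic_diff harmonic_cmult) auto
  have dK: "d y + ?K f y = ennreal b * f y" if "y \<in> E" for y
    using le[OF that] by (simp add: d_def diff_add_cancel_ennreal)
  have "?K d x + ?K (?K f) x = ?K (\<lambda>y. d y + ?K f y) x"
    by (rule harmonic_part_add[symmetric, OF d Kf harmonic_add[OF d Kf] u x])
  also have "\<dots> = ?K (\<lambda>y. ennreal b * f y) x"
    using dK u x by (rule harmonic_part_cong)
  also have "\<dots> = ennreal b * ?K f x"
    using f u x by (intro harmonic_part_cmult) auto
  finally have eq: "?K d x + ?K (?K f) x = ennreal b * ?K f x" .
  have 1: "?K d x \<le> ennreal b * d x" using ub d x by (auto simp: upper_def)
  have 2: "?K (?K f) x \<le> ennreal (c\<^sup>2) * f x"
    using upperD[OF uuc f x] harmonic_part_mult[OF f u u x] by simp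
  obtain F where F: "0 \<le> F" "f x = ennreal F" using harmonic_real[OF f x] .
  obtain k where k: "0 \<le> k" "?K f x = ennreal k" using harmonic_real[OF Kf x] .
  obtain D where D: "0 \<le> D" "d x = ennreal D" using harmonic_real[OF d x] .
  have KKf: "harmonic (?K (?K f))" using Kf u by (rule harmonic_part_harmonic)
  have Kd: "harmonic (?K d)" using d u by (rule harmonic_part_harmonic)
  obtain kk where kk: "0 \<le> kk" "?K (?K f) x = ennreal kk" using harmonic_real[OF KKf x] .
  obtain kd where kd: "0 \<le> kd" "?K d x = ennreal kd" using harmonic_real[OF Kd x] .
  have e1: "kd + kk = b * k" using eq b k kk kd by (simp flip: ennreal_mult ennreal_plus)
  have e2: "kd \<le> b * D" using 1 b D kd by (simp flip: ennreal_mult)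
  have e3: "kk \<le> c\<^sup>2 * F" using 2 F kk by (simp flip: ennreal_mult)
  have e4: "D + k = b * F" using dK[OF x] b D F k by (simp flip: ennreal_mult ennreal_plus)
  have "b * D + b * k = b\<^sup>2 * F" using arg_cong[OF e4, of "\<lambda>r. b * r"] by (simp add: power2_eq_square distrib_left)
  then have "2 * b * k \<le> (b\<^sup>2 + c\<^sup>2) * F" using e1 e2 e3 by (simp add: distrib_right)
  then have "k \<le> (b\<^sup>2 + c\<^sup>2) / (2 * b) * F" using b by (simp add: field_simps)
  then show "?K f x \<le> ennreal ((b\<^sup>2 + c\<^sup>2) / (2 * b)) * f x"
    using b F k by (simp flip: ennreal_mult)
qed

text \<open>With d = K f - a f harmonic, K d <= b d says K^2 f + a b f <= (a + b) K f, and K^2 f is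
  at least c^2 f. The new constant exceeds a as long as a < c.\<close>

lemma lower_step:
  assumes u: "u \<in> E" and a: "0 \<le> a" and b: "0 < b"
    and ub: "upper u b" and la: "lower u a" and uuc: "lower (u \<otimes> u) (c\<^sup>2)"
  shows "lower u ((c\<^sup>2 + a * b) / (a + b))"
  unfolding lower_def
proof safe
  fix f x assume f: "harmonic f" and x: "x \<in> E"
  let ?K = "harmonic_part u"
  define d where "d = (\<lambda>y. ?K f y - ennreal a * f y)"
  have Kf: "harmonic (?K f)" using f u by (rule harmonic_part_harmonic)
  have af: "harmonic (\<lambda>y. ennreal a * f y)" using f by (intro harmonic_cmult) auto
  have le: "ennreal a * f y \<le> ?K f y" if "y \<in> E" for y using la f that by (auto simp: lower_def)
  have d: "harmonic d" unfolding d_def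
    using af Kf le by (intro harmonic_diff) auto
  have dK: "d y + ennreal a * f y = ?K f y" if "y \<in> E" for y
    using le[OF that] by (simp add: d_def diff_add_cancel_ennreal)
  have "?K d x + ?K (\<lambda>y. ennreal a * f y) x = ?K (\<lambda>y. d y + ennreal a * f y) x"
    by (rule harmonic_part_add[symmetric, OF d af harmonic_add[OF d af] u x])
  also have "\<dots> = ?K (?K f) x"
    using dK u x by (rule harmonic_part_cong)
  also have "?K (\<lambda>y. ennreal a * f y) x = ennreal a * ?K f x"
    using f u x by (intro harmonic_part_cmult) auto
  finally have eq: "?K d x + ennreal a * ?K f x = ?K (?K f) x" .
  have 1: "?K d x \<le> ennreal b * d x" using ub d x by (auto simp: upper_def)
  have 2: "ennreal (c\<^sup>2) * f x \<le> ?K (?K f) x"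
    using lowerD[OF uuc f x] harmonic_part_mult[OF f u u x] by simp
  obtain F where F: "0 \<le> F" "f x = ennreal F" using harmonic_real[OF f x] .
  obtain k where k: "0 \<le> k" "?K f x = ennreal k" using harmonic_real[OF Kf x] .
  obtain D where D: "0 \<le> D" "d x = ennreal D" using harmonic_real[OF d x] .
  have KKf: "harmonic (?K (?K f))" using Kf u by (rule harmonic_part_harmonic)
  have Kd: "harmonic (?K d)" using d u by (rule harmonic_part_harmonic)
  obtain kk where kk: "0 \<le> kk" "?K (?K f) x = ennreal kk" using harmonic_real[OF KKf x] .
  obtain kd where kd: "0 \<le> kd" "?K d x = ennreal kd" using harmonic_real[OF Kd x] .
  have e1: "kd + a * k = kk" using eq a k kk kd by (simp flip: ennreal_mult ennreal_plus)
  have e2: "kd \<le> b * D" using 1 b D kd by (simp flip: ennreal_mult)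
  have e3: "c\<^sup>2 * F \<le> kk" using 2 F kk by (simp flip: ennreal_mult)
  have e4: "D + a * F = k" using dK[OF x] a D F k by (simp flip: ennreal_mult ennreal_plus)
  have "b * D + a * b * F = b * k" using arg_cong[OF e4, of "\<lambda>r. b * r"] by (simp add: distrib_left mult.left_commute mult.assoc)
  then have "(c\<^sup>2 + a * b) * F \<le> (a + b) * k" using e1 e2 e3 by (simp add: distrib_right)
  then have "(c\<^sup>2 + a * b) / (a + b) * F \<le> k" using a b by (simp add: field_simps)
  then show "ennreal ((c\<^sup>2 + a * b) / (a + b)) * f x \<le> ?K f x"
    using a b F k by (simp flip: ennreal_mult)
qed

lemma upper_mono: "upper u b \<Longrightarrow> b \<le> c \<Longrightarrow> upper u c"
  unfolding upper_def by (meson ennreal_leI mult_right_mono order_trans zero_le)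

lemma lower_antimono: "lower u b \<Longrightarrow> c \<le> b \<Longrightarrow> lower u c"
  unfolding lower_def by (meson ennreal_leI mult_right_mono order_trans zero_le)

text \<open>The bound is a closed condition at each point, so the best constant is attained.\<close>

lemma upper_Inf:
  assumes "B \<noteq> {}" "\<And>b. b \<in> B \<Longrightarrow> 0 \<le> b" "\<And>b. b \<in> B \<Longrightarrow> upper u b" "u \<in> E"
  shows "upper u (Inf B)"
  unfolding upper_def
proof safe
  fix f x assume f: "harmonic f" and x: "x \<in> E"
  obtain F where F: "0 \<le> F" "f x = ennreal F" using harmonic_real[OF f x] .
  obtain k where k: "0 \<le> k" "harmonic_part u f x = ennreal k"
    using harmonic_real[OF harmonic_part_harmonic[OF f assms(4)] x] .
  have le: "k \<le> b * F" if "b \<in> B" for b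
    using assms(2)[OF that] upperD[OF assms(3)[OF that] f x] F k by (simp flip: ennreal_mult)
  have "k \<le> Inf B * F"
  proof (cases "F = 0")
    case True
    then show ?thesis using le assms(1) by fastforce
  next
    case False
    then have "k / F \<le> Inf B"
      using assms(1) le F by (intro cInf_greatest) (auto simp: field_simps)
    then show ?thesis using False F by (simp add: field_simps)
  qed
  moreover have "0 \<le> Inf B" using assms(1,2) by (intro cInf_greatest)
  ultimately show "harmonic_part u f x \<le> ennreal (Inf B) * f x"
    using F k by (simp flip: ennreal_mult)
qed

lemma lower_Sup:
  assumes "A \<noteq> {}" "\<And>a. a \<in> A \<Longrightarrow> 0 \<le> a \<and> a \<le> c" "\<And>a. a \<in> A \<Longrightarrow> lower u a" "u \<in> E"
  shows "lower u (Sup A)"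
  unfolding lower_def
proof safe
  fix f x assume f: "harmonic f" and x: "x \<in> E"
  obtain F where F: "0 \<le> F" "f x = ennreal F" using harmonic_real[OF f x] .
  obtain k where k: "0 \<le> k" "harmonic_part u f x = ennreal k"
    using harmonic_real[OF harmonic_part_harmonic[OF f assms(4)] x] .
  have le: "a * F \<le> k" if "a \<in> A" for a
    using assms(2)[OF that] lowerD[OF assms(3)[OF that] f x] F k by (simp flip: ennreal_mult)
  have "Sup A * F \<le> k"
  proof (cases "F = 0")
    case False
    then have "Sup A \<le> k / F"
      using assms(1) le F by (intro cSup_least) (auto simp: field_simps)
    then show ?thesis using False F by (simp add: field_simps)
  qed (use k in simp)
  moreover have "0 \<le> Sup A"
    using assms(1,2) by (meson bdd_aboveI cSup_upper2 ex_in_conv)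
  ultimately show "ennreal (Sup A) * f x \<le> harmonic_part u f x"
    using F k by (simp flip: ennreal_mult)
qed

text \<open>If the best constant exceeded c, Heron's step would produce a strictly smaller
  one.\<close>

lemma upper_sqrt:
  assumes u: "u \<in> E" and b: "0 < b" "upper u b" and c: "0 < c" and uuc: "upper (u \<otimes> u) (c\<^sup>2)"
  shows "upper u c"
proof -
  define B where "B = {b. 0 \<le> b \<and> upper u b}"
  have B: "B \<noteq> {}" "bdd_below B" using b by (auto simp: B_def intro!: exI[of _ b] bdd_belowI[of _ 0])
  have up: "upper u (Inf B)" using u B by (intro upper_Inf) (auto simp: B_def)
  have "Inf B \<le> c"
  proof (rule ccontr)
    assume "\<not> Inf B \<le> c"
    then have gt: "c < Inf B" by simp
    then have "upper u (((Inf B)\<^sup>2 + c\<^sup>2) / (2 * Inf B))"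
      using c by (intro upper_step u up uuc) auto
    then have "((Inf B)\<^sup>2 + c\<^sup>2) / (2 * Inf B) \<in> B" using gt c by (auto simp: B_def)
    then have "Inf B \<le> ((Inf B)\<^sup>2 + c\<^sup>2) / (2 * Inf B)" using B by (intro cInf_lower) auto
    then have "(Inf B)\<^sup>2 \<le> c\<^sup>2" using gt c by (simp add: field_simps power2_eq_square)
    then show False using gt c by (simp add: power2_le_iff_abs_le)
  qed
  then show ?thesis using up upper_mono by blast
qed

text \<open>A best constant below c would be improved by \<open>lower_step\<close>, which also uses
  the upper bound b.\<close>

lemma lower_sqrt:
  assumes u: "u \<in> E" and b: "0 < b" "upper u b" and c: "0 \<le> c" and uuc: "lower (u \<otimes> u) (c\<^sup>2)"
  shows "lower u c"
proof -
  \<comment> \<open>The cap at c bounds the set: if zero were the only harmonic function, every a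
    would be a lower constant.\<close>
  define A where "A = {a. 0 \<le> a \<and> a \<le> c \<and> lower u a}"
  have A: "0 \<in> A" "bdd_above A" using c by (auto simp: A_def lower_def intro!: bdd_aboveI[of _ c])
  have lo: "lower u (Sup A)" using u A by (intro lower_Sup[of _ c]) (auto simp: A_def)
  have S0: "0 \<le> Sup A" using A by (intro cSup_upper) auto
  have "c \<le> Sup A"
  proof (rule ccontr)
    assume "\<not> c \<le> Sup A"
    then have gt: "Sup A < c" by simp
    let ?a = "(c\<^sup>2 + Sup A * b) / (Sup A + b)"
    have "lower u ?a" using b by (intro lower_step u lo uuc S0) auto
    then have "lower u (min ?a c)" by (rule lower_antimono) simp
    then have "min ?a c \<in> A" using S0 b c by (auto simp: A_def)
    then have "min ?a c \<le> Sup A" using A by (intro cSup_upper) auto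
    then have "?a \<le> Sup A" using gt by linarith
    then have "c\<^sup>2 \<le> (Sup A)\<^sup>2" using S0 b by (simp add: field_simps power2_eq_square)
    then show False using gt S0 c by (simp add: power2_le_iff_abs_le)
  qed
  then show ?thesis using lo lower_antimono by blast
qed

lemma pow_double: "u \<in> E \<Longrightarrow> u [^] (2 ^ Suc n :: nat) = u [^] (2 ^ n :: nat) \<otimes> u [^] (2 ^ n :: nat)"
  by (simp add: nat_pow_mult E_carrier mult_2)

text \<open>Each use of \<open>upper_sqrt\<close> halves the exponent, of u and of c alike. Some
  finite bound must be available at every intermediate power of u to start it.\<close>

lemma upper_dyadic_root:
  assumes "u \<in> E" "\<And>v. v \<in> E \<Longrightarrow> \<exists>b>0. upper v b" "0 < c" "upper (u [^] (2 ^ n :: nat)) (c ^ (2 ^ n))"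
  shows "upper u c"
  using assms(4)
proof (induction n)
  case (Suc n)
  obtain b where b: "0 < b" "upper (u [^] (2 ^ n :: nat)) b" using assms(1,2) E_pow by blast
  have sq: "c ^ (2 ^ Suc n) = (c ^ (2 ^ n))\<^sup>2"
    using power_mult[of c "2 ^ n" 2] by (simp add: mult.commute)
  have "upper (u [^] (2 ^ n :: nat)) (c ^ (2 ^ n))"
    using assms(1,3) Suc.prems unfolding pow_double[OF assms(1)] sq
    by (intro upper_sqrt[OF _ b]) auto
  then show ?case by (rule Suc.IH)
qed (use assms(1) in \<open>simp add: E_carrier\<close>)

lemma lower_dyadic_root:
  assumes "u \<in> E" "\<And>v. v \<in> E \<Longrightarrow> \<exists>b>0. upper v b" "0 < c" "lower (u [^] (2 ^ n :: nat)) (c ^ (2 ^ n))"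
  shows "lower u c"
  using assms(4)
proof (induction n)
  case (Suc n)
  obtain b where b: "0 < b" "upper (u [^] (2 ^ n :: nat)) b" using assms(1,2) E_pow by blast
  have sq: "c ^ (2 ^ Suc n) = (c ^ (2 ^ n))\<^sup>2"
    using power_mult[of c "2 ^ n" 2] by (simp add: mult.commute)
  have "lower (u [^] (2 ^ n :: nat)) (c ^ (2 ^ n))"
    using assms(1,3) Suc.prems unfolding pow_double[OF assms(1)] sq
    by (intro lower_sqrt[OF _ b]) auto
  then show ?case by (rule Suc.IH)
qed (use assms(1) in \<open>simp add: E_carrier\<close>)

section \<open>Slow variation and the identity K_u f = f\<close>

text \<open>Slow variation restated for harmonic functions, uniformly in f and x, so that no process
  appears. It is derived from the hitting probabilities in
  \<open>slowly_varying_if_hitting\<close>.\<close>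

definition slowly_varying :: bool where
  "slowly_varying \<longleftrightarrow> (\<forall>u\<in>E. \<forall>\<epsilon>>0. \<exists>N. \<forall>n\<ge>N. \<forall>f x. harmonic f \<longrightarrow> x \<in> E \<longrightarrow>
     f (x \<otimes> u [^] n) \<le> ennreal (exp (\<epsilon> * real n)) * f x \<and>
     f x \<le> ennreal (exp (\<epsilon> * real n)) * f (x \<otimes> u [^] n))"

lemma slowly_varyingE:
  assumes slowly_varying "u \<in> E" "0 < \<epsilon>"
  obtains N where "\<And>n f x. N \<le> n \<Longrightarrow> harmonic f \<Longrightarrow> x \<in> E \<Longrightarrow> f (x \<otimes> u [^] (n::nat)) \<le> ennreal (exp (\<epsilon> * real n)) * f x"
    and "\<And>n f x. N \<le> n \<Longrightarrow> harmonic f \<Longrightarrow> x \<in> E \<Longrightarrow> f x \<le> ennreal (exp (\<epsilon> * real n)) * f (x \<otimes> u [^] (n::nat))"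
  using assms unfolding slowly_varying_def by metis

text \<open>Slow variation controls large powers of u only. A single step is reached by going from x
  u up to x u^(N+1) and from there back to x.\<close>

lemma upper_exists:
  assumes slowly_varying "u \<in> E"
  shows "\<exists>b>0. upper u b"
proof -
  obtain N where N: "\<And>n f x. N \<le> n \<Longrightarrow> harmonic f \<Longrightarrow> x \<in> E \<Longrightarrow> f (x \<otimes> u [^] (n::nat)) \<le> ennreal (exp (1 * real n)) * f x"
    "\<And>n f x. N \<le> n \<Longrightarrow> harmonic f \<Longrightarrow> x \<in> E \<Longrightarrow> f x \<le> ennreal (exp (1 * real n)) * f (x \<otimes> u [^] (n::nat))"
    using slowly_varyingE[OF assms, of 1] by auto
  have "upper u (exp (real N) * exp (real (Suc N)))"
    unfolding upper_def
  proof safe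
    fix f x assume f: "harmonic f" and x: "x \<in> E"
    have xu: "x \<otimes> u \<otimes> u [^] N = x \<otimes> u [^] Suc N"
      using x assms(2) by (metis E_carrier m_assoc nat_pow_Suc2 nat_pow_closed)
    have "harmonic_part u f x \<le> f (x \<otimes> u)" by (rule harmonic_part_le)
    also have "\<dots> \<le> ennreal (exp (real N)) * f (x \<otimes> u [^] Suc N)"
      using N(2)[of N f "x \<otimes> u"] f x assms(2) xu by (simp del: nat_pow_Suc)
    also have "\<dots> \<le> ennreal (exp (real N)) * (ennreal (exp (real (Suc N))) * f x)"
      using N(1)[of "Suc N" f x] f x by (intro mult_left_mono) (auto simp del: nat_pow_Suc)
    finally show "harmonic_part u f x \<le> ennreal (exp (real N) * exp (real (Suc N))) * f x"
      by (simp add: ennreal_mult mult.assoc)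
  qed
  then show ?thesis by (intro exI[of _ "exp (real N) * exp (real (Suc N))"]) auto
qed

text \<open>
  The map \<open>f \<mapsto> harmonic_part u f\<close> is order-bounded by multiples of the identity, so it behaves like
  multiplication by a function, and slow variation forces that function to be 1.
\<close>

theorem harmonic_part_eq:
  assumes sv: slowly_varying and f: "harmonic f" and u: "u \<in> E" and x: "x \<in> E"
  shows "harmonic_part u f x = f x"
proof (rule antisym)
  obtain F where F: "0 \<le> F" "f x = ennreal F" using harmonic_real[OF f x] .
  obtain k where k: "0 \<le> k" "harmonic_part u f x = ennreal k"
    using harmonic_real[OF harmonic_part_harmonic[OF f u] x] .
  have bounds: "k \<le> exp \<epsilon> * F \<and> exp (- \<epsilon>) * F \<le> k" if \<epsilon>: "0 < \<epsilon>" for \<epsilon>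
  proof -
    obtain N where N: "\<And>n f x. N \<le> n \<Longrightarrow> harmonic f \<Longrightarrow> x \<in> E \<Longrightarrow> f (x \<otimes> u [^] (n::nat)) \<le> ennreal (exp (\<epsilon> * real n)) * f x"
      "\<And>n f x. N \<le> n \<Longrightarrow> harmonic f \<Longrightarrow> x \<in> E \<Longrightarrow> f x \<le> ennreal (exp (\<epsilon> * real n)) * f (x \<otimes> u [^] (n::nat))"
      using slowly_varyingE[OF sv u \<epsilon>] by blast
    \<comment> \<open>A power of two, so that dyadic roots apply, and at least N, so that the slow
      variation bounds apply.\<close>
    define m :: nat where "m = 2 ^ N"
    have mN: "N \<le> m" by (simp add: m_def less_imp_le)
    have ex: "exp (\<epsilon> * real m) = exp \<epsilon> ^ m"
      using exp_of_nat_mult[of m \<epsilon>] by (simp add: mult.commute)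
    have "upper (u [^] m) (exp \<epsilon> ^ m)"
      unfolding upper_def ex[symmetric]
      by (intro allI impI order_trans[OF harmonic_part_le] N(1) mN)
    then have up: "upper u (exp \<epsilon>)"
      unfolding m_def by (rule upper_dyadic_root[OF u _ exp_gt_zero, rotated]) (rule upper_exists[OF sv])
    have "lower (u [^] m) (exp (- \<epsilon>) ^ m)"
      unfolding lower_def
    proof safe
      fix g y assume g: "harmonic g" and y: "y \<in> E"
      have um: "u [^] m \<in> E" using u by auto
      show "ennreal (exp (- \<epsilon>) ^ m) * g y \<le> harmonic_part (u [^] m) g y"
        unfolding harmonic_part_def
      proof (rule INF_greatest)
        fix n
        \<comment> \<open>The bound on the shifted function survives all powers of P, because g is
          harmonic.\<close>
        have le: "ennreal (exp (- \<epsilon>) ^ m) * g z \<le> shift (u [^] m) g z" if z: "z \<in> E" for z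
        proof -
          have "ennreal (exp (- \<epsilon>) ^ m) * g z \<le>
              ennreal (exp (- \<epsilon>) ^ m) * (ennreal (exp (\<epsilon> * real m)) * g (z \<otimes> u [^] m))"
            using N(2)[OF mN g z] by (rule mult_left_mono) simp
          also have "\<dots> = ennreal (exp (- \<epsilon>) ^ m * exp (\<epsilon> * real m)) * g (z \<otimes> u [^] m)"
            by (simp add: ennreal_mult mult.assoc)
          also have "exp (- \<epsilon>) ^ m * exp (\<epsilon> * real m) = 1"
            unfolding ex by (simp add: exp_minus power_inverse)
          finally show ?thesis by (simp add: shift_def)
        qed
        have "ennreal (exp (- \<epsilon>) ^ m) * g y = (P ^^ n) (\<lambda>z. ennreal (exp (- \<epsilon>) ^ m) * g z) y"
          using kernel_pow_harmonic[OF harmonicD(1)[OF g] y, of n] by (simp add: kernel_pow_cmult)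
        also have "\<dots> \<le> (P ^^ n) (shift (u [^] m) g) y"
          using le y by (rule kernel_pow_mono)
        finally show "ennreal (exp (- \<epsilon>) ^ m) * g y \<le> (P ^^ n) (shift (u [^] m) g) y" .
      qed
    qed
    then have lo: "lower u (exp (- \<epsilon>))"
      unfolding m_def by (rule lower_dyadic_root[OF u _ exp_gt_zero, rotated]) (rule upper_exists[OF sv])
    show ?thesis
      using upperD[OF up f x] lowerD[OF lo f x] F k by (simp flip: ennreal_mult)
  qed
  \<comment> \<open>The two bounds close up as \<epsilon> decreases to 0.\<close>
  have "((\<lambda>\<epsilon>. exp \<epsilon> * F) \<longlongrightarrow> exp 0 * F) (at_right 0)" "((\<lambda>\<epsilon>. exp (- \<epsilon>) * F) \<longlongrightarrow> exp (- 0) * F) (at_right 0)"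
    by (intro tendsto_intros)+
  moreover have "\<forall>\<^sub>F \<epsilon> in at_right 0. k \<le> exp \<epsilon> * F" "\<forall>\<^sub>F \<epsilon> in at_right 0. exp (- \<epsilon>) * F \<le> k"
    using bounds by (auto simp: eventually_at_filter)
  ultimately have "k \<le> exp 0 * F" "exp (- 0) * F \<le> k"
    by (auto intro: tendsto_lowerbound tendsto_upperbound)
  then show "harmonic_part u f x \<le> f x" "f x \<le> harmonic_part u f x"
    using F k by (auto simp: ennreal_leI)
qed

section \<open>Renewal equations for the ladder kernel\<close>

text \<open>The Riesz decomposition at e: its potential part is P_H f by
  \<open>ladder_op_eq\<close>, and its harmonic part is f(e).\<close>

corollary harmonic_ladder:
  assumes "countable E" slowly_varying "harmonic f" "u \<in> E"
  shows "f u = f \<one> + kernel_op E ladder f u"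
  using riesz_shift[OF assms(3,4) E_one] harmonic_part_eq[OF assms(2-4) E_one] assms
  by (simp add: ladder_op_eq E_carrier add.commute)

text \<open>The analogue for the potential g = G 1. Its source 1 contributes G 1(e), while the
  remainder P^n T_u g <= T_u P^n g vanishes in the limit.\<close>

lemma potential_one_ladder:
  defines "g \<equiv> potential E k (\<lambda>_. 1)"
  assumes "countable E" and fin: "\<And>x. x \<in> E \<Longrightarrow> g x < \<infinity>" and u: "u \<in> E"
  shows "g u = g \<one> + kernel_op E ladder g u"
proof -
  have *: "shift u g y = (1 + defect u g y) + P (shift u g) y" if "y \<in> E" for y
    using P_shift[OF u that, of g] potential_eq[of E k "\<lambda>_. 1" "y \<otimes> u"]
    by (simp add: shift_def g_def add_ac)
  have lim: "(\<lambda>n. (P ^^ n) g (\<one> \<otimes> u)) \<longlonglongrightarrow> 0"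
    unfolding g_def using fin u unfolding g_def by (intro kernel_pow_potential_tendsto_0) auto
  have 0: "(\<lambda>n. (P ^^ n) (shift u g) \<one>) \<longlonglongrightarrow> 0"
    by (rule tendsto_sandwich[OF _ _ tendsto_const lim]) (auto intro!: always_eventually P_pow_shift_le u)
  have "(\<lambda>n. (\<Sum>t<n. (P ^^ t) (\<lambda>_. 1) \<one>) + (\<Sum>t<n. (P ^^ t) (defect u g) \<one>) + (P ^^ n) (shift u g) \<one>)
      \<longlonglongrightarrow> g \<one> + potential E k (defect u g) \<one> + 0"
    unfolding g_def by (intro tendsto_add LIMSEQ_potential 0[unfolded g_def])
  moreover have "(\<Sum>t<n. (P ^^ t) (\<lambda>_. 1) \<one>) + (\<Sum>t<n. (P ^^ t) (defect u g) \<one>) + (P ^^ n) (shift u g) \<one>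
      = shift u g \<one>" for n
    using kernel_iterate[of E "shift u g" "\<lambda>y. 1 + defect u g y" k \<one> n, OF * E_one]
    by (simp add: kernel_pow_add sum.distrib)
  ultimately show ?thesis
    using u assms(2) by (simp add: LIMSEQ_const_iff shift_def ladder_op_eq E_carrier)
qed

end

section \<open>The renewal function of the ladder kernel\<close>

context semigroup_kernel
begin

text \<open>Extra killing with probability 1 - s at each step preserves the hypotheses. For s < 1 it
  makes G 1 finite, so that \<open>potential_one_ladder\<close> becomes available.\<close>

lemma semigroup_kernel_scaled:
  assumes "0 \<le> s" "s \<le> 1"
  shows "semigroup_kernel G E (\<lambda>x y. s * p x y)"
proof (intro semigroup_kernel.intro semigroup_kernel_axioms.intro)
  show "group G" "submonoid E G" by (rule is_group, rule submonoid)
  show "Defs.substochastic E (\<lambda>x y. s * p x y)"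
    unfolding substochastic_def
  proof safe
    fix x assume x: "x \<in> E"
    have "(\<integral>\<^sup>+ y. ennreal (s * p x y) \<partial>count_space E) \<le> (\<integral>\<^sup>+ y. ennreal (p x y) \<partial>count_space E)"
      using assms p_nonneg[OF x] by (intro nn_integral_mono ennreal_leI) (auto intro: mult_left_le_one_le)
    also have "\<dots> \<le> 1"
      using substochastic x by (auto simp: substochastic_def)
    finally show "(\<integral>\<^sup>+ y. ennreal (s * p x y) \<partial>count_space E) \<le> 1" .
  qed (use assms p_nonneg in auto)
qed (use assms shift_increasing in \<open>auto intro: mult_left_mono\<close>)

abbreviation "scaled_kernel s \<equiv> \<lambda>x y. ennreal (s * p x y)"
abbreviation "scaled_ladder s \<equiv> semigroup_kernel.ladder G E (\<lambda>x y. s * p x y)"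

lemma scaled_op: "0 \<le> s \<Longrightarrow> kernel_op E (scaled_kernel s) f x = ennreal s * P f x"
  unfolding kernel_op_def by (simp add: ennreal_mult' mult.assoc nn_integral_cmult)

lemma scaled_pow:
  assumes "0 \<le> s"
  shows "(kernel_op E (scaled_kernel s) ^^ n) f = (\<lambda>x. ennreal s ^ n * (P ^^ n) f x)"
proof (induction n)
  case (Suc n)
  show ?case
  proof
    fix x
    have "(kernel_op E (scaled_kernel s) ^^ Suc n) f x
        = kernel_op E (scaled_kernel s) (\<lambda>x. ennreal s ^ n * (P ^^ n) f x) x"
      by (simp only: funpow.simps o_apply Suc.IH)
    also have "\<dots> = ennreal s ^ Suc n * (P ^^ Suc n) f x"
      unfolding scaled_op[OF assms] kernel_op_cmult by (simp add: mult_ac)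
    finally show "(kernel_op E (scaled_kernel s) ^^ Suc n) f x = ennreal s ^ Suc n * (P ^^ Suc n) f x" .
  qed
qed simp

lemma scaled_defect:
  assumes "0 \<le> s" "s \<le> 1"
  shows "semigroup_kernel.defect G E (\<lambda>x y. s * p x y) u f = (\<lambda>x. ennreal s * defect u f x)"
proof
  fix x
  have "ladder_coeff G E (\<lambda>x y. s * p x y) u x y = s * ladder_coeff G E p u x y" for y
    by (simp add: ladder_coeff_def algebra_simps)
  then show "semigroup_kernel.defect G E (\<lambda>x y. s * p x y) u f x = ennreal s * defect u f x"
    unfolding semigroup_kernel.defect_def[OF semigroup_kernel_scaled[OF assms]] defect_def kernel_op_def
    using assms by (simp add: ennreal_mult' mult.assoc nn_integral_cmult)
qed

text \<open>The exponent is t + 1: t factors s come from the Green function and one from A_u, which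
  is linear in \<open>p\<close>.\<close>

lemma scaled_ladder_op:
  assumes "countable E" "0 \<le> s" "s \<le> 1"
  shows "kernel_op E (scaled_ladder s) f u = (\<Sum>t. ennreal s ^ Suc t * (P ^^ t) (defect u f) \<one>)"
  unfolding semigroup_kernel.ladder_op_eq[OF semigroup_kernel_scaled[OF assms(2,3)] assms(1)]
    scaled_defect[OF assms(2,3)] potential_cmult
  unfolding potential_def scaled_pow[OF assms(2)]
  by (simp add: mult.assoc)

lemma scaled_ladder_mono:
  assumes "countable E" "0 \<le> s" "s \<le> r" "r \<le> 1"
  shows "kernel_op E (scaled_ladder s) f u \<le> kernel_op E (scaled_ladder r) f u"
  using assms
  by (simp add: scaled_ladder_op del: power_Suc) (intro suminf_le mult_right_mono power_mono; simp)

lemma scaled_ladder_le: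
  assumes "countable E" "0 \<le> s" "s \<le> 1"
  shows "kernel_op E (scaled_ladder s) f u \<le> kernel_op E ladder f u"
proof -
  have "(\<Sum>t. ennreal s ^ Suc t * (P ^^ t) (defect u f) \<one>) \<le> (\<Sum>t. (P ^^ t) (defect u f) \<one>)"
  proof (rule suminf_le)
    fix t
    have "ennreal s ^ Suc t \<le> 1"
      using assms(2,3) by (intro power_le_one) auto
    then show "ennreal s ^ Suc t * (P ^^ t) (defect u f) \<one> \<le> (P ^^ t) (defect u f) \<one>"
      using mult_right_mono[of "ennreal s ^ Suc t" 1 "(P ^^ t) (defect u f) \<one>"] by simp
  qed auto
  then show ?thesis
    using assms by (simp add: scaled_ladder_op ladder_op_eq potential_def del: power_Suc)
qed

text \<open>The constant 1/(1 - s) is a supersolution, since s/(1 - s) + 1 = 1/(1 - s).\<close>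

lemma scaled_potential_one_bounded:
  assumes "0 \<le> s" "s < 1" "x \<in> E"
  shows "potential E (scaled_kernel s) (\<lambda>_. 1) x \<le> ennreal (1 / (1 - s))"
proof -
  have "kernel_op E (scaled_kernel s) (\<lambda>_. ennreal (1 / (1 - s))) y + 1 \<le> ennreal (1 / (1 - s))"
    if y: "y \<in> E" for y
  proof -
    have "kernel_op E (scaled_kernel s) (\<lambda>_. ennreal (1 / (1 - s)) * 1) y
        = ennreal s * (ennreal (1 / (1 - s)) * P (\<lambda>_. 1) y)"
      using assms by (simp only: kernel_op_cmult scaled_op mult.left_commute)
    also have "\<dots> \<le> ennreal s * (ennreal (1 / (1 - s)) * 1)"
      using P_one_le[OF y] by (intro mult_left_mono) auto
    also have "\<dots> + 1 = ennreal (s * (1 / (1 - s)) + 1)"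
      using assms by (simp add: ennreal_mult'[symmetric])
    also have "s * (1 / (1 - s)) + 1 = 1 / (1 - s)"
      using assms by (simp add: field_simps)
    finally show ?thesis by (simp add: add_right_mono)
  qed
  then show ?thesis
    using assms(3) by (intro potential_le) (auto simp: add.commute)
qed

lemma potential_one_ge: "1 \<le> potential E l (\<lambda>_. 1) x"
  using potential_eq[of E l "\<lambda>_. 1" x] by simp

text \<open>The normalized potential r = g / g(e) solves r = 1 + L r for the scaled ladder kernel L,
  so by minimality it dominates the left side. It also satisfies r <= W, and r = 1/g(e) + s P r then
  yields the bound.\<close>

lemma scaled_potential_le_subharmonic:
  fixes s :: real
  defines "g \<equiv> potential E (scaled_kernel s) (\<lambda>_. 1)"
  defines "W \<equiv> potential E ladder (\<lambda>_. 1)"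
  assumes ce: "countable E" and s: "0 \<le> s" "s < 1" and W: "\<And>x. x \<in> E \<Longrightarrow> W x < \<infinity>" and x: "x \<in> E"
  shows "potential E (scaled_ladder s) (\<lambda>_. 1) x \<le> inverse (g \<one>) + P W x"
proof -
  let ?L = "kernel_op E (scaled_ladder s)"
  note sc = semigroup_kernel_scaled[of s]
  have gle: "g y \<le> ennreal (1 / (1 - s))" if "y \<in> E" for y
    unfolding g_def using s that by (rule scaled_potential_one_bounded)
  have fin: "g y < \<infinity>" if "y \<in> E" for y
    using gle[OF that] by (simp add: le_less_trans)
  define c where "c = inverse (g \<one>)"
  have c1: "c * g \<one> = 1"
    using fin[OF E_one] potential_one_ge[of "scaled_kernel s" \<one>]
    by (auto simp: c_def g_def mult.commute divide_ennreal_def[symmetric] intro!: ennreal_divide_self)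
  have cle: "c \<le> 1"
    using mult_left_mono[OF potential_one_ge[of "scaled_kernel s" \<one>], of c] c1 by (simp add: g_def)
  define r where "r = (\<lambda>y. c * g y)"
  have L: "r y = 1 + ?L r y" if "y \<in> E" for y
    using semigroup_kernel.potential_one_ladder[OF sc ce, of y] s fin that
    by (simp add: r_def kernel_op_cmult g_def c1[unfolded g_def] distrib_left)
  \<comment> \<open>Since r <= 1 + P_H r, iterating gives r <= W plus a remainder. As r is at most a
    multiple of W, that remainder is at most the same multiple of an iterate of the finite potential
    W, which tends to 0.\<close>
  have up: "r y \<le> W y" if y: "y \<in> E" for y
  proof -
    have le: "r z \<le> 1 + kernel_op E ladder r z" if "z \<in> E" for z
      using L[OF that] scaled_ladder_le[OF ce, of s r z] s by (metis add_left_mono less_imp_le)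
    have "r y \<le> W y + ennreal (1 / (1 - s)) * (kernel_op E ladder ^^ n) W y" for n
    proof -
      have "r y \<le> (\<Sum>t<n. (kernel_op E ladder ^^ t) (\<lambda>_. 1) y) + (kernel_op E ladder ^^ n) r y"
        using le y by (rule kernel_iterate_le)
      also have "\<dots> \<le> W y + (kernel_op E ladder ^^ n) (\<lambda>z. ennreal (1 / (1 - s)) * W z) y"
      proof (rule add_mono)
        show "(\<Sum>t<n. (kernel_op E ladder ^^ t) (\<lambda>_. 1) y) \<le> W y"
          unfolding W_def potential_def by (rule sum_le_suminf) auto
        show "(kernel_op E ladder ^^ n) r y \<le> (kernel_op E ladder ^^ n) (\<lambda>z. ennreal (1 / (1 - s)) * W z) y"
        proof (rule kernel_pow_mono[OF _ y])
          fix z assume z: "z \<in> E"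
          have "c * g z \<le> 1 * (ennreal (1 / (1 - s)) * 1)"
            using cle gle[OF z] by (intro mult_mono) auto
          also have "\<dots> \<le> 1 * (ennreal (1 / (1 - s)) * W z)"
            unfolding W_def by (intro mult_left_mono potential_one_ge) auto
          finally show "r z \<le> ennreal (1 / (1 - s)) * W z" by (simp add: r_def)
        qed
      qed
      finally show ?thesis by (simp add: kernel_pow_cmult)
    qed
    moreover have "(\<lambda>n. W y + ennreal (1 / (1 - s)) * (kernel_op E ladder ^^ n) W y)
        \<longlonglongrightarrow> W y + ennreal (1 / (1 - s)) * 0"
      using W[OF y] unfolding W_def
      by (intro tendsto_add tendsto_const ennreal_tendsto_cmult kernel_pow_potential_tendsto_0) auto
    ultimately have "r y \<le> W y + ennreal (1 / (1 - s)) * 0"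
      by (intro LIMSEQ_le_const) auto
    then show ?thesis by simp
  qed
  have "potential E (scaled_ladder s) (\<lambda>_. 1) x \<le> r x"
    using L x by (intro potential_le) auto
  also have "r x = c + ennreal s * P r x"
    using s unfolding r_def kernel_op_cmult g_def
    by (subst potential_eq) (simp add: scaled_op distrib_left mult.left_commute)
  also have "\<dots> \<le> c + 1 * P W x"
    using s up by (intro add_left_mono mult_mono kernel_op_mono) auto
  finally show ?thesis by (simp add: c_def)
qed

text \<open>The bound V_s <= 1/g_s(e) + P W is passed to the limit as s increases to 1: g_s(e) tends
  to G 1(e) = \<infinity>, and the supremum of the V_s is at least W because it is a supersolution
  for \<open>ladder\<close>.\<close>

lemma ladder_potential_subharmonic:
  defines "W \<equiv> potential E ladder (\<lambda>_. 1)"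
  assumes ce: "countable E" and W: "\<And>x. x \<in> E \<Longrightarrow> W x < \<infinity>"
    and inf: "potential E k (\<lambda>_. 1) \<one> = \<infinity>" and x: "x \<in> E"
  shows "W x \<le> P W x"
proof -
  define s where "s = (\<lambda>i::nat. 1 - 1 / (real i + 2))"
  have s: "0 \<le> s i" "s i < 1" for i by (auto simp: s_def field_simps)
  have s1: "s i \<le> 1" for i using s[of i] by simp
  have smono: "s i \<le> s j" if "i \<le> j" for i j
    using that by (simp add: s_def frac_le)
  have slim: "s \<longlonglongrightarrow> 1" unfolding s_def by real_asymp
  have powlim: "(\<lambda>i. ennreal (s i) ^ n * a) \<longlonglongrightarrow> a" for n a
  proof -
    have "(\<lambda>i. ennreal (s i ^ n)) \<longlonglongrightarrow> ennreal (1 ^ n)"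
      by (intro tendsto_ennrealI tendsto_power slim)
    then have "(\<lambda>i. ennreal (s i) ^ n) \<longlonglongrightarrow> 1" by (simp add: ennreal_power s)
    then have "(\<lambda>i. ennreal (s i) ^ n * a) \<longlonglongrightarrow> 1 * a"
      by (intro tendsto_mult_ennreal) auto
    then show ?thesis by simp
  qed
  let ?L = "\<lambda>i. kernel_op E (scaled_ladder (s i))"
  define V where "V = (\<lambda>i. potential E (scaled_ladder (s i)) (\<lambda>_. 1))"
  define R where "R = (\<lambda>y. SUP i. V i y)"
  have Veq: "V i y = 1 + ?L i (V i) y" for i y
    unfolding V_def by (rule potential_eq)
  have Lmono: "?L i f y \<le> ?L j f y" if "i \<le> j" for i j f y
    using scaled_ladder_mono[OF ce s(1) smono[OF that] s1] .
  \<comment> \<open>By minimality: \<open>V j\<close> solves its own equation and is thus a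
    supersolution for the smaller operator \<open>?L i\<close>.\<close>
  have Vmono: "V i y \<le> V j y" if "i \<le> j" "y \<in> E" for i j y
    unfolding V_def
  proof (rule potential_le[OF _ that(2)])
    fix z assume "z \<in> E"
    show "1 + ?L i (potential E (scaled_ladder (s j)) (\<lambda>_. 1)) z \<le> potential E (scaled_ladder (s j)) (\<lambda>_. 1) z"
      using Veq[of j z] Lmono[OF that(1), of "V j" z] by (simp add: V_def)
  qed
  have R: "1 + ?L j R y \<le> R y" if y: "y \<in> E" for j y
  proof -
    have "?L j R y = (SUP i. ?L j (V i) y)"
      unfolding R_def by (rule kernel_op_SUP) (auto intro: Vmono)
    then have "1 + ?L j R y = (SUP i. 1 + ?L j (V i) y)"
      by (simp add: ennreal_SUP_add_right)
    also have "\<dots> \<le> R y"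
    proof (rule SUP_least)
      fix i
      have "1 + ?L j (V i) y \<le> 1 + ?L (max i j) (V (max i j)) y"
        by (intro add_left_mono order_trans[OF Lmono kernel_op_mono]) (auto intro: Vmono)
      also have "\<dots> = V (max i j) y" by (rule Veq[symmetric])
      also have "\<dots> \<le> R y" unfolding R_def by (rule SUP_upper) simp
      finally show "1 + ?L j (V i) y \<le> R y" .
    qed
    finally show ?thesis .
  qed
  have "1 + kernel_op E ladder R y \<le> R y" if y: "y \<in> E" for y
  proof -
    \<comment> \<open>For t < n each weight s^(t+1) is at least s^n, so a finite sum is controlled
      by one factor tending to 1; afterwards n goes to infinity.\<close>
    have "1 + (\<Sum>t<n. (P ^^ t) (defect y R) \<one>) \<le> R y" for n
    proof (rule LIMSEQ_le_const2)
      show "(\<lambda>i. 1 + ennreal (s i) ^ n * (\<Sum>t<n. (P ^^ t) (defect y R) \<one>))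
          \<longlonglongrightarrow> 1 + (\<Sum>t<n. (P ^^ t) (defect y R) \<one>)"
        by (intro tendsto_add tendsto_const powlim)
      have "1 + ennreal (s i) ^ n * (\<Sum>t<n. (P ^^ t) (defect y R) \<one>) \<le> R y" for i
      proof -
        have "ennreal (s i) ^ n * (\<Sum>t<n. (P ^^ t) (defect y R) \<one>)
            \<le> (\<Sum>t<n. ennreal (s i) ^ Suc t * (P ^^ t) (defect y R) \<one>)"
          unfolding sum_distrib_left using s1
          by (intro sum_mono mult_right_mono power_decreasing) auto
        also have "\<dots> \<le> ?L i R y"
          unfolding scaled_ladder_op[OF ce s(1) s1] by (rule sum_le_suminf) auto
        finally show ?thesis using R[OF y, of i] by (meson add_left_mono order_trans)
      qed
      then show "\<exists>N. \<forall>i\<ge>N. 1 + ennreal (s i) ^ n * (\<Sum>t<n. (P ^^ t) (defect y R) \<one>) \<le> R y" by blast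
    qed
    moreover have "(\<lambda>n. 1 + (\<Sum>t<n. (P ^^ t) (defect y R) \<one>)) \<longlonglongrightarrow> 1 + potential E k (defect y R) \<one>"
      by (intro tendsto_add tendsto_const LIMSEQ_potential)
    ultimately show ?thesis
      unfolding ladder_op_eq[OF ce] by (intro LIMSEQ_le_const2) auto
  qed
  then have "W x \<le> R x" unfolding W_def by (rule potential_le[OF _ x])
  also have "R x \<le> P W x"
    unfolding R_def
  proof (rule SUP_least)
    fix j
    define c where "c = (\<lambda>i. potential E (scaled_kernel (s i)) (\<lambda>_. 1) \<one>)"
    \<comment> \<open>A partial sum of the divergent series exceeding a still exceeds a after
      multiplication by s^n, once s is close enough to 1.\<close>
    have "c \<longlonglongrightarrow> \<infinity>"
    proof (rule order_tendstoI)
      fix a :: ennreal assume "a < \<infinity>"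
      moreover have "(\<lambda>n. \<Sum>t<n. (P ^^ t) (\<lambda>_. 1) \<one>) \<longlonglongrightarrow> \<infinity>"
        using LIMSEQ_potential[of E k "\<lambda>_. 1" \<one>] inf by simp
      ultimately have "\<forall>\<^sub>F n in sequentially. a < (\<Sum>t<n. (P ^^ t) (\<lambda>_. 1) \<one>)"
        by (rule order_tendstoD(1)[rotated])
      then obtain n where n: "a < (\<Sum>t<n. (P ^^ t) (\<lambda>_. 1) \<one>)"
        unfolding eventually_sequentially by blast
      have "\<forall>\<^sub>F i in sequentially. a < ennreal (s i) ^ n * (\<Sum>t<n. (P ^^ t) (\<lambda>_. 1) \<one>)"
        using powlim n by (rule order_tendstoD(1))
      moreover have "ennreal (s i) ^ n * (\<Sum>t<n. (P ^^ t) (\<lambda>_. 1) \<one>) \<le> c i" for i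
      proof -
        have "ennreal (s i) ^ n * (\<Sum>t<n. (P ^^ t) (\<lambda>_. 1) \<one>)
            \<le> (\<Sum>t<n. (kernel_op E (scaled_kernel (s i)) ^^ t) (\<lambda>_. 1) \<one>)"
          unfolding sum_distrib_left scaled_pow[OF s(1)] using s1
          by (intro sum_mono mult_right_mono power_decreasing) auto
        also have "\<dots> \<le> c i"
          unfolding c_def potential_def by (rule sum_le_suminf) auto
        finally show ?thesis .
      qed
      ultimately show "\<forall>\<^sub>F i in sequentially. a < c i"
        by (elim eventually_mono) (blast intro: less_le_trans)
    qed auto
    then have "(\<lambda>i. inverse (c i)) \<longlonglongrightarrow> inverse \<infinity>"
      by (rule continuous_on_tendsto_compose[OF continuous_on_inverse_ennreal[OF continuous_on_id, of UNIV]]) auto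
    then have "(\<lambda>i. inverse (c i) + P W x) \<longlonglongrightarrow> 0 + P W x"
      by (intro tendsto_add tendsto_const) simp
    \<comment> \<open>The index j is held fixed while i grows, so that the first summand
      disappears.\<close>
    moreover have "V j x \<le> inverse (c i) + P W x" if "j \<le> i" for i
      using Vmono[OF that x] scaled_potential_le_subharmonic[OF ce s W[unfolded W_def] x, of i]
      unfolding V_def c_def W_def by (meson order_trans)
    ultimately have "V j x \<le> 0 + P W x" by (intro LIMSEQ_le_const) auto
    then show "V j x \<le> P W x" by simp
  qed
  finally show ?thesis .
qed

end

section \<open>Trajectories of the chain\<close>

text \<open>Forward recursion for the probability of staying in B_i at each time i <= n and ending
  in s. The time-dependent constraints cover both survival and avoidance of a given state.\<close>

fun path_weight ::
    "'a set \<Rightarrow> ('a \<Rightarrow> 'a \<Rightarrow> ennreal) \<Rightarrow> 'a \<Rightarrow> (nat \<Rightarrow> 'a option set) \<Rightarrow> nat \<Rightarrow> 'a option \<Rightarrow> ennreal" where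
  "path_weight E k x B 0 s = (if s = Some x \<and> s \<in> B 0 then 1 else 0)"
| "path_weight E k x B (Suc n) s = (if s \<in> B (Suc n) then
     (\<integral>\<^sup>+ r. path_weight E k x B n r * completed_kernel E k r s \<partial>count_space (insert None (Some ` E))) else 0)"

lemma path_weight_cong:
  "(\<And>i. i \<le> n \<Longrightarrow> B i = C i) \<Longrightarrow> path_weight E k x B n s = path_weight E k x C n s"
proof (induction n arbitrary: s)
  case (Suc n)
  have "path_weight E k x B n = path_weight E k x C n" using Suc by (intro ext) auto
  then show ?case using Suc.prems[of "Suc n"] by simp
qed simp

lemma nn_integral_count_space_option:
  "(\<integral>\<^sup>+ r. f r \<partial>count_space (insert None (Some ` E))) = f None + (\<integral>\<^sup>+ z. f (Some z) \<partial>count_space E)"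
proof -
  have "(\<integral>\<^sup>+ r. f r \<partial>count_space (insert None (Some ` E)))
      = (\<integral>\<^sup>+ r. f r * indicator {None} r + f r * indicator (Some ` E) r \<partial>count_space (insert None (Some ` E)))"
    by (intro nn_integral_cong) (auto split: split_indicator)
  also have "\<dots> = (\<integral>\<^sup>+ r. f r * indicator {None} r \<partial>count_space (insert None (Some ` E)))
      + (\<integral>\<^sup>+ r. f r * indicator (Some ` E) r \<partial>count_space (insert None (Some ` E)))"
    by (intro nn_integral_add) auto
  also have "(\<integral>\<^sup>+ r. f r * indicator {None} r \<partial>count_space (insert None (Some ` E)))
      = (\<Sum>r\<in>{None}. f r * indicator {None} r)"
    by (intro nn_integral_count_space') (auto split: split_indicator)
  also have "(\<integral>\<^sup>+ r. f r * indicator (Some ` E) r \<partial>count_space (insert None (Some ` E)))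
      = (\<integral>\<^sup>+ r. f r * indicator (Some ` E) r \<partial>count_space (Some ` E))"
    by (rule nn_integral_count_space_eq) (auto split: split_indicator)
  also have "\<dots> = (\<integral>\<^sup>+ z. f (Some z) \<partial>count_space E)"
    by (subst nn_integral_bij_count_space[of Some E, symmetric])
      (auto simp: bij_betw_def intro!: nn_integral_cong)
  finally show ?thesis by simp
qed

lemma path_weight_Suc_Some:
  "path_weight E k x B (Suc n) (Some y) =
    (if Some y \<in> B (Suc n) then (\<integral>\<^sup>+ z. path_weight E k x B n (Some z) * k z y \<partial>count_space E) else 0)"
  by (simp add: nn_integral_count_space_option completed_kernel_def)

text \<open>The constraints may exclude only the cemetery, from which no state of \<open>E\<close>
  is reached anyway. The induction moves the last step from the weight onto f, hence the
  generalization over f.\<close>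

lemma path_weight_integral:
  assumes "countable E" "x \<in> E" "\<And>i y. y \<in> E \<Longrightarrow> Some y \<in> B i"
  shows "(\<integral>\<^sup>+ y. path_weight E k x B n (Some y) * f y \<partial>count_space E) = (kernel_op E k ^^ n) f x"
proof (induction n arbitrary: f)
  case 0
  have "(\<integral>\<^sup>+ y. path_weight E k x B 0 (Some y) * f y \<partial>count_space E)
      = (\<Sum>y\<in>{x}. path_weight E k x B 0 (Some y) * f y)"
    using assms by (intro nn_integral_count_space') auto
  then show ?case using assms by simp
next
  case (Suc n)
  let ?w = "path_weight E k x B n"
  have "(\<integral>\<^sup>+ y. path_weight E k x B (Suc n) (Some y) * f y \<partial>count_space E)
      = (\<integral>\<^sup>+ y. (\<integral>\<^sup>+ z. ?w (Some z) * (k z y * f y) \<partial>count_space E) \<partial>count_space E)"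
    using assms(3) by (intro nn_integral_cong)
      (simp add: path_weight_Suc_Some nn_integral_multc mult.assoc[symmetric] del: path_weight.simps)
  also have "\<dots> = (\<integral>\<^sup>+ z. (\<integral>\<^sup>+ y. ?w (Some z) * (k z y * f y) \<partial>count_space E) \<partial>count_space E)"
    using assms(1) by (intro nn_integral_count_space_nn_integral) auto
  also have "\<dots> = (\<integral>\<^sup>+ z. ?w (Some z) * kernel_op E k f z \<partial>count_space E)"
    by (simp add: nn_integral_cmult kernel_op_def)
  also have "\<dots> = (kernel_op E k ^^ Suc n) f x"
    by (simp only: Suc.IH kernel_pow_Suc')
  finally show ?case .
qed

section \<open>Laws of a Markov chain, used for both the chain and its ladder process\<close>

locale chain =
  fixes E :: "'a set" and k :: "'a \<Rightarrow> 'a \<Rightarrow> ennreal" and M :: "'a \<Rightarrow> 'w measure"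
    and X :: "nat \<Rightarrow> 'w \<Rightarrow> 'a option"
  assumes countable: "countable E" and markov: "markov_chain E k M X"
begin

abbreviation "states \<equiv> insert None (Some ` E)"

lemma prob_space: "x \<in> E \<Longrightarrow> prob_space (M x)"
  and X_measurable: "x \<in> E \<Longrightarrow> X t \<in> M x \<rightarrow>\<^sub>M count_space states"
  and trajectory: "\<lbrakk>x \<in> E; \<And>i. i \<le> n \<Longrightarrow> s i \<in> states\<rbrakk> \<Longrightarrow>
    emeasure (M x) {\<omega> \<in> space (M x). \<forall>i\<le>n. X i \<omega> = s i} =
      (if s 0 = Some x then \<Prod>i<n. completed_kernel E k (s i) (s (Suc i)) else 0)"
  using markov by (auto simp: markov_chain_def)

lemma X_in_states: "x \<in> E \<Longrightarrow> \<omega> \<in> space (M x) \<Longrightarrow> X t \<omega> \<in> states"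
  using X_measurable[of x t] by (auto dest: measurable_space)

lemma sets_X_in: "x \<in> E \<Longrightarrow> {\<omega> \<in> space (M x). X t \<omega> \<in> A} \<in> sets (M x)"
proof -
  assume x: "x \<in> E"
  have "{\<omega> \<in> space (M x). X t \<omega> \<in> A} = X t -` (A \<inter> states) \<inter> space (M x)"
    using X_in_states[OF x] by auto
  then show ?thesis using measurable_sets[OF X_measurable[OF x], of "A \<inter> states" t] by simp
qed

lemma sets_X_eq: "x \<in> E \<Longrightarrow> {\<omega> \<in> space (M x). X t \<omega> = s} \<in> sets (M x)"
  using sets_X_in[of x t "{s}"] by simp

lemma sets_past: "x \<in> E \<Longrightarrow> {\<omega> \<in> space (M x). \<forall>i\<le>n. X i \<omega> \<in> B i} \<in> sets (M x)"
  using sets.sets_Collect_countable_All[of "M x" "\<lambda>i \<omega>. i \<le> n \<longrightarrow> X i \<omega> \<in> B i"] sets_X_in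
  by (simp add: sets.sets_Collect_imp)

text \<open>The prescribed trajectory after time n makes the induction work: the constraint at the
  last time is traded for a sum over the state one step earlier, which is prepended by
  \<open>case_nat\<close>. For n = 0 it is the defining property of the chain.\<close>

lemma emeasure_path:
  assumes x: "x \<in> E" and "\<And>j. j \<le> m \<Longrightarrow> s j \<in> states"
  shows "emeasure (M x) {\<omega> \<in> space (M x). (\<forall>i\<le>n. X i \<omega> \<in> B i) \<and> (\<forall>j\<le>m. X (n + j) \<omega> = s j)}
    = path_weight E k x B n (s 0) * (\<Prod>j<m. completed_kernel E k (s j) (s (Suc j)))"
  using assms(2)
proof (induction n arbitrary: m s)
  case 0
  show ?case
  proof (cases "s 0 \<in> B 0")
    case True
    then have "{\<omega> \<in> space (M x). (\<forall>i\<le>0. X i \<omega> \<in> B i) \<and> (\<forall>j\<le>m. X (0 + j) \<omega> = s j)}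
        = {\<omega> \<in> space (M x). \<forall>j\<le>m. X j \<omega> = s j}" by force
    then show ?thesis using True trajectory[OF x 0] by simp
  next
    case False
    then have "{\<omega> \<in> space (M x). (\<forall>i\<le>0. X i \<omega> \<in> B i) \<and> (\<forall>j\<le>m. X (0 + j) \<omega> = s j)} = {}" by force
    then show ?thesis using False by (metis (no_types, lifting) emeasure_empty mult_zero_left path_weight.simps(1))
  qed
next
  case (Suc n)
  let ?A = "\<lambda>r. {\<omega> \<in> space (M x). (\<forall>i\<le>n. X i \<omega> \<in> B i) \<and> (\<forall>j\<le>Suc m. X (n + j) \<omega> = case_nat r s j)}"
  let ?S = "{\<omega> \<in> space (M x). (\<forall>i\<le>Suc n. X i \<omega> \<in> B i) \<and> (\<forall>j\<le>m. X (Suc n + j) \<omega> = s j)}"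
  let ?Q = "\<Prod>j<m. completed_kernel E k (s j) (s (Suc j))"
  show ?case
  proof (cases "s 0 \<in> B (Suc n)")
    case True
    have splitall: "(\<forall>j\<le>Suc m. X (n + j) \<omega> = case_nat r s j) \<longleftrightarrow> X n \<omega> = r \<and> (\<forall>j\<le>m. X (Suc n + j) \<omega> = s j)"
      for r \<omega>
    proof -
      have "(\<forall>j\<le>Suc m. Q j) \<longleftrightarrow> Q 0 \<and> (\<forall>j\<le>m. Q (Suc j))" for Q :: "nat \<Rightarrow> bool"
        by (metis Suc_le_mono not0_implies_Suc zero_le)
      from this[of "\<lambda>j. X (n + j) \<omega> = case_nat r s j"] show ?thesis by simp
    qed
    \<comment> \<open>A disjoint decomposition according to the state at time n.\<close>
    have S: "?S = (\<Union>r\<in>states. ?A r)"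
    proof (intro subset_antisym subsetI)
      fix \<omega> assume \<omega>: "\<omega> \<in> ?S"
      then have "X n \<omega> \<in> states" by (intro X_in_states[OF x]) auto
      moreover have "\<omega> \<in> ?A (X n \<omega>)" using \<omega> splitall[of \<omega> "X n \<omega>"] by auto
      ultimately show "\<omega> \<in> (\<Union>r\<in>states. ?A r)" by blast
    next
      fix \<omega> assume "\<omega> \<in> (\<Union>r\<in>states. ?A r)"
      then obtain r where \<omega>: "\<omega> \<in> ?A r" by blast
      then have "X (Suc n) \<omega> = s 0" using splitall[of \<omega> r] by force
      then show "\<omega> \<in> ?S" using \<omega> splitall[of \<omega> r] True by (auto simp: le_Suc_eq)
    qed
    have meas: "?A r \<in> sets (M x)" for r
    proof -
      have "?A r = {\<omega> \<in> space (M x). \<forall>i\<le>n. X i \<omega> \<in> B i} \<inter>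
          (\<Inter>j\<in>{..Suc m}. {\<omega> \<in> space (M x). X (n + j) \<omega> = case_nat r s j})" by auto
      also have "\<dots> \<in> sets (M x)"
        using x by (intro sets.Int sets_past sets.finite_INT sets_X_eq) auto
      finally show ?thesis .
    qed
    have AX: "X n \<omega> = q" if "\<omega> \<in> ?A q" for q \<omega>
      using that splitall[of \<omega> q] by simp
    have disj: "disjoint_family_on ?A states"
      unfolding disjoint_family_on_def
    proof (intro ballI impI equals0I)
      fix r r' \<omega> assume "r \<noteq> r'" and \<omega>: "\<omega> \<in> ?A r \<inter> ?A r'"
      from AX[OF IntD1[OF \<omega>]] AX[OF IntD2[OF \<omega>]] show False using \<open>r \<noteq> r'\<close> by simp
    qed
    have "countable states" using countable by simp
    then have "emeasure (M x) ?S = (\<integral>\<^sup>+ r. emeasure (M x) (?A r) \<partial>count_space states)"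
      unfolding S by (rule emeasure_UN_countable[OF meas _ disj])
    also have "\<dots> = (\<integral>\<^sup>+ r. path_weight E k x B n r * completed_kernel E k r (s 0) * ?Q \<partial>count_space states)"
    proof (rule nn_integral_cong)
      fix r assume "r \<in> space (count_space states)"
      then have r: "r \<in> states" by simp
      have "emeasure (M x) (?A r) = path_weight E k x B n (case_nat r s 0) *
          (\<Prod>j<Suc m. completed_kernel E k (case_nat r s j) (case_nat r s (Suc j)))"
        using r Suc.prems by (intro Suc.IH) (auto split: nat.split)
      then show "emeasure (M x) (?A r) = path_weight E k x B n r * completed_kernel E k r (s 0) * ?Q"
        by (simp add: prod.lessThan_Suc_shift mult.assoc del: prod.lessThan_Suc)
    qed
    also have "\<dots> = path_weight E k x B (Suc n) (s 0) * ?Q"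
      using True by (simp add: nn_integral_multc)
    finally show ?thesis .
  next
    case False
    then have "?S = {}" by force
    then show ?thesis using False by (metis (no_types, lifting) emeasure_empty mult_zero_left path_weight.simps(2))
  qed
qed

lemma emeasure_path_end:
  assumes "x \<in> E" "s \<in> states"
  shows "emeasure (M x) {\<omega> \<in> space (M x). (\<forall>i\<le>n. X i \<omega> \<in> B i) \<and> X n \<omega> = s} = path_weight E k x B n s"
  using emeasure_path[OF assms(1), of 0 "\<lambda>_. s" n B] assms(2) by simp

lemma sets_path_end:
  assumes "x \<in> E"
  shows "{\<omega> \<in> space (M x). (\<forall>i\<le>n. X i \<omega> \<in> B i) \<and> X m \<omega> = s} \<in> sets (M x)"
proof -
  have "{\<omega> \<in> space (M x). (\<forall>i\<le>n. X i \<omega> \<in> B i) \<and> X m \<omega> = s}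
      = {\<omega> \<in> space (M x). \<forall>i\<le>n. X i \<omega> \<in> B i} \<inter> {\<omega> \<in> space (M x). X m \<omega> = s}" by auto
  then show ?thesis by (simp only:) (intro sets.Int sets_past sets_X_eq assms)
qed

lemma emeasure_X_eq:
  assumes "x \<in> E" "z \<in> E"
  shows "emeasure (M x) {\<omega> \<in> space (M x). X n \<omega> = Some z} = (kernel_op E k ^^ n) (indicator {z}) x"
proof -
  let ?w = "\<lambda>y. path_weight E k x (\<lambda>_. UNIV) n (Some y)"
  have "(kernel_op E k ^^ n) (indicator {z}) x = (\<integral>\<^sup>+ y. ?w y * indicator {z} y \<partial>count_space E)"
    using assms countable by (intro path_weight_integral[symmetric]) auto
  also have "\<dots> = (\<Sum>y\<in>{z}. ?w y * indicator {z} y)"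
    using assms by (intro nn_integral_count_space') auto
  finally show ?thesis
    using emeasure_path_end[OF assms(1), of "Some z" n "\<lambda>_. UNIV"] assms(2) by simp
qed

text \<open>The integrand is decomposed over the value of \<open>X n\<close>; each piece has the
  path weight that forbids the cemetery at all times up to n.\<close>

lemma surviving_integral:
  assumes x: "x \<in> E"
  shows "(\<integral>\<^sup>+ \<omega>. (case X n \<omega> of Some y \<Rightarrow> f y | None \<Rightarrow> 0) * indicator {\<omega>. \<forall>i\<le>n. X i \<omega> \<noteq> None} \<omega> \<partial>M x)
    = (kernel_op E k ^^ n) f x"
proof -
  let ?B = "\<lambda>i::nat. - {None :: 'a option}"
  define A where "A = (\<lambda>y. {\<omega> \<in> space (M x). (\<forall>i\<le>n. X i \<omega> \<in> ?B i) \<and> X n \<omega> = Some y})"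
  have A [measurable]: "A y \<in> sets (M x)" for y
    unfolding A_def by (rule sets_path_end[OF x])
  have "(\<integral>\<^sup>+ \<omega>. (case X n \<omega> of Some y \<Rightarrow> f y | None \<Rightarrow> 0) * indicator {\<omega>. \<forall>i\<le>n. X i \<omega> \<noteq> None} \<omega> \<partial>M x)
      = (\<integral>\<^sup>+ \<omega>. (\<integral>\<^sup>+ y. f y * indicator (A y) \<omega> \<partial>count_space E) \<partial>M x)"
  proof (rule nn_integral_cong)
    fix \<omega> assume \<omega>: "\<omega> \<in> space (M x)"
    show "(case X n \<omega> of Some y \<Rightarrow> f y | None \<Rightarrow> 0) * indicator {\<omega>. \<forall>i\<le>n. X i \<omega> \<noteq> None} \<omega>
        = (\<integral>\<^sup>+ y. f y * indicator (A y) \<omega> \<partial>count_space E)"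
    proof (cases "X n \<omega>")
      case None
      then show ?thesis by (simp add: A_def)
    next
      case (Some z)
      then have z: "z \<in> E" using X_in_states[OF x \<omega>, of n] by auto
      have "(\<integral>\<^sup>+ y. f y * indicator (A y) \<omega> \<partial>count_space E) = (\<Sum>y\<in>{z}. f y * indicator (A y) \<omega>)"
        using z Some by (intro nn_integral_count_space') (auto simp: A_def)
      then show ?thesis using Some \<omega> by (simp add: indicator_def A_def)
    qed
  qed
  also have "\<dots> = (\<integral>\<^sup>+ y. (\<integral>\<^sup>+ \<omega>. f y * indicator (A y) \<omega> \<partial>M x) \<partial>count_space E)"
    using countable by (intro nn_integral_count_space_nn_integral) auto
  also have "\<dots> = (\<integral>\<^sup>+ y. path_weight E k x ?B n (Some y) * f y \<partial>count_space E)"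
  proof (rule nn_integral_cong)
    fix y assume "y \<in> space (count_space E)"
    then have "emeasure (M x) (A y) = path_weight E k x ?B n (Some y)"
      unfolding A_def by (intro emeasure_path_end x) auto
    then show "(\<integral>\<^sup>+ \<omega>. f y * indicator (A y) \<omega> \<partial>M x) = path_weight E k x ?B n (Some y) * f y"
      by (simp add: nn_integral_cmult_indicator[OF A] mult.commute)
  qed
  also have "\<dots> = (kernel_op E k ^^ n) f x"
    using countable x by (intro path_weight_integral) auto
  finally show ?thesis .
qed

section \<open>Killing times\<close>

lemma less_killing_time_iff: "of_nat n < killing_time t\<^sub>0 Y \<omega> \<longleftrightarrow> (\<forall>i\<le>n. t\<^sub>0 \<le> i \<longrightarrow> Y i \<omega> \<noteq> None)"
proof
  assume less: "of_nat n < killing_time t\<^sub>0 Y \<omega>"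
  show "\<forall>i\<le>n. t\<^sub>0 \<le> i \<longrightarrow> Y i \<omega> \<noteq> None"
  proof (intro allI impI notI)
    fix i assume i: "i \<le> n" "t\<^sub>0 \<le> i" "Y i \<omega> = None"
    then have "killing_time t\<^sub>0 Y \<omega> \<le> of_nat i" unfolding killing_time_def by (intro INF_lower) auto
    also have "\<dots> \<le> of_nat n" using i by simp
    finally show False using less by simp
  qed
next
  assume all: "\<forall>i\<le>n. t\<^sub>0 \<le> i \<longrightarrow> Y i \<omega> \<noteq> None"
  have "(of_nat n :: ennreal) < of_nat (Suc n)"
    unfolding ennreal_of_nat_eq_real_of_nat by (intro ennreal_lessI) auto
  also have "\<dots> \<le> killing_time t\<^sub>0 Y \<omega>"
    unfolding killing_time_def
  proof (rule INF_greatest)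
    fix t assume "t \<in> {t. t\<^sub>0 \<le> t \<and> Y t \<omega> = None}"
    then have "\<not> t \<le> n" using all by blast
    then have "Suc n \<le> t" by simp
    then show "(of_nat (Suc n) :: ennreal) \<le> of_nat t" by (rule of_nat_mono)
  qed
  finally show "of_nat n < killing_time t\<^sub>0 Y \<omega>" .
qed

text \<open>The tail formula, T as the sum of the indicators of T > n. If the cemetery is never
  reached, both sides are infinite.\<close>

lemma killing_time_eq_suminf:
  "killing_time t\<^sub>0 Y \<omega> = (\<Sum>n. indicator {\<omega>. \<forall>i\<le>n. t\<^sub>0 \<le> i \<longrightarrow> Y i \<omega> \<noteq> None} \<omega>)"
proof -
  let ?T = "{t. t\<^sub>0 \<le> t \<and> Y t \<omega> = None}"
  show ?thesis
  proof (cases "?T = {}")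
    case True
    then have 1: "killing_time t\<^sub>0 Y \<omega> = \<infinity>" by (simp add: killing_time_def)
    have "(\<Sum>n. indicator {\<omega>. \<forall>i\<le>n. t\<^sub>0 \<le> i \<longrightarrow> Y i \<omega> \<noteq> None} \<omega>) = (\<Sum>n::nat. (1::ennreal))"
      using True by (intro suminf_cong) (auto simp: indicator_def)
    also have "\<dots> = \<infinity>" by (simp add: suminf_eq_SUP ennreal_SUP_of_nat_eq_top)
    finally show ?thesis using 1 by simp
  next
    case False
    define m where "m = (LEAST t. t \<in> ?T)"
    have m: "m \<in> ?T" unfolding m_def using False by (metis (no_types, lifting) LeastI ex_in_conv)
    have mle: "m \<le> t" if "t \<in> ?T" for t unfolding m_def using that by (rule Least_le)
    have 1: "killing_time t\<^sub>0 Y \<omega> = of_nat m"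
      unfolding killing_time_def using m mle by (intro antisym INF_lower INF_greatest) auto
    have "(\<Sum>n. indicator {\<omega>. \<forall>i\<le>n. t\<^sub>0 \<le> i \<longrightarrow> Y i \<omega> \<noteq> None} \<omega>)
        = (\<Sum>n<m. indicator {\<omega>. \<forall>i\<le>n. t\<^sub>0 \<le> i \<longrightarrow> Y i \<omega> \<noteq> None} \<omega> :: ennreal)"
      using m by (intro suminf_finite) (auto simp: indicator_def not_less)
    also have "\<dots> = (\<Sum>n<m. 1)"
      using mle by (intro sum.cong) (force simp: indicator_def not_less[symmetric])+
    finally show ?thesis using 1 by simp
  qed
qed

lemma AE_start: "x \<in> E \<Longrightarrow> AE \<omega> in M x. X 0 \<omega> = Some x"
  using prob_space.AE_in_set_eq_1[OF prob_space, of x "{\<omega> \<in> space (M x). X 0 \<omega> = Some x}"]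
    emeasure_X_eq[of x x 0] sets_X_eq[of x 0 "Some x"]
  by (auto simp: measure_def)

text \<open>Covers both conventions, times from 0 and times from 1: they agree almost surely, as the
  chain starts in \<open>E\<close>.\<close>

lemma expected_killing_time_eq:
  assumes x: "x \<in> E" and t\<^sub>0: "t\<^sub>0 \<le> 1"
  shows "expected_killing_time t\<^sub>0 M X x = potential E k (\<lambda>_. 1) x"
proof -
  let ?I = "\<lambda>n \<omega>. indicator {\<omega>. \<forall>i\<le>n. X i \<omega> \<noteq> None} \<omega> :: ennreal"
  have meas: "?I n \<in> borel_measurable (M x)" for n
  proof -
    have "(\<lambda>\<omega>. indicator {\<omega> \<in> space (M x). \<forall>i\<le>n. X i \<omega> \<in> - {None}} \<omega> :: ennreal) \<in> borel_measurable (M x)"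
      using sets_past[OF x, of n "\<lambda>_. - {None}"] by (intro borel_measurable_indicator)
    then show ?thesis
      by (rule measurable_cong[THEN iffD1, rotated]) (auto simp: indicator_def)
  qed
  have "AE \<omega> in M x. killing_time t\<^sub>0 X \<omega> = (\<Sum>n. ?I n \<omega>)"
    using AE_start[OF x]
  proof eventually_elim
    case (elim \<omega>)
    have "(t\<^sub>0 \<le> i \<longrightarrow> X i \<omega> \<noteq> None) \<longleftrightarrow> X i \<omega> \<noteq> None" for i
      using elim t\<^sub>0 by (cases i) auto
    then show ?case by (simp add: killing_time_eq_suminf indicator_def)
  qed
  then have "expected_killing_time t\<^sub>0 M X x = (\<integral>\<^sup>+ \<omega>. (\<Sum>n. ?I n \<omega>) \<partial>M x)"
    unfolding expected_killing_time_def by (rule nn_integral_cong_AE)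
  also have "\<dots> = (\<Sum>n. \<integral>\<^sup>+ \<omega>. ?I n \<omega> \<partial>M x)"
    using meas by (rule nn_integral_suminf)
  also have "\<dots> = (\<Sum>n. (kernel_op E k ^^ n) (\<lambda>_. 1) x)"
  proof (rule suminf_cong)
    fix n
    have "(\<integral>\<^sup>+ \<omega>. ?I n \<omega> \<partial>M x) = (\<integral>\<^sup>+ \<omega>. (case X n \<omega> of Some y \<Rightarrow> 1 | None \<Rightarrow> 0) * ?I n \<omega> \<partial>M x)"
      by (intro nn_integral_cong) (auto simp: indicator_def split: option.split)
    then show "(\<integral>\<^sup>+ \<omega>. ?I n \<omega> \<partial>M x) = (kernel_op E k ^^ n) (\<lambda>_. 1) x"
      using surviving_integral[OF x, where n = n and f = "\<lambda>_. 1"] by simp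
  qed
  finally show ?thesis by (simp add: potential_def)
qed

lemma surviving_mean_eq:
  assumes x: "x \<in> E"
  shows "surviving_mean M X h x n = (kernel_op E k ^^ n) (\<lambda>y. ennreal (h y)) x"
  using surviving_integral[OF x, where n = n and f = "\<lambda>y. ennreal (h y)"]
  by (simp add: surviving_mean_def less_killing_time_iff)

section \<open>The Harnack inequality and consequences of irreducibility\<close>

text \<open>A superharmonic function does not increase in mean along the chain stopped at its first
  visit to y; counting only what is collected at y gives Q(x,y) f(y).\<close>

lemma hit_prob_mult_le:
  assumes x: "x \<in> E" and y: "y \<in> E" and super: "\<And>z. z \<in> E \<Longrightarrow> kernel_op E k f z \<le> f z"
  shows "ennreal (hit_prob M X x y) * f y \<le> f x"
proof -
  interpret px: prob_space "M x" by (rule prob_space[OF x])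
  \<comment> \<open>Time 0 is left free, because \<open>hit_prob\<close> counts only positive times
    and x may equal y.\<close>
  define B where "B = (\<lambda>i::nat. if i = 0 then UNIV else - {Some y})"
  define v where "v = (\<lambda>n z. path_weight E k x B n (Some z))"
  define A where "A = (\<lambda>n. {\<omega> \<in> space (M x). (\<forall>i\<le>n. X i \<omega> \<in> B i) \<and> X (Suc n) \<omega> = Some y})"
  have A_sets: "A n \<in> sets (M x)" for n
    unfolding A_def by (rule sets_path_end[OF x])
  define u where "u = (\<lambda>n. \<integral>\<^sup>+ z. v n z * k z y \<partial>count_space E)"
  have A_eq: "emeasure (M x) (A n) = u n" for n
  proof -
    \<comment> \<open>\<open>B\<close> forbids y at time n + 1; lifting that single constraint
      describes a first visit exactly then.\<close>
    let ?C = "B(Suc n := UNIV)"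
    have "A n = {\<omega> \<in> space (M x). (\<forall>i\<le>Suc n. X i \<omega> \<in> ?C i) \<and> X (Suc n) \<omega> = Some y}"
      unfolding A_def by (auto simp: le_Suc_eq)
    then have "emeasure (M x) (A n) = path_weight E k x ?C (Suc n) (Some y)"
      using emeasure_path_end[OF x, of "Some y" "Suc n" ?C] y by simp
    also have "\<dots> = (\<integral>\<^sup>+ z. path_weight E k x ?C n (Some z) * k z y \<partial>count_space E)"
      by (simp add: path_weight_Suc_Some del: path_weight.simps)
    also have "\<dots> = u n"
      unfolding u_def v_def using path_weight_cong[of n ?C B] by simp
    finally show ?thesis .
  qed
  \<comment> \<open>The mean of f at the stopped chain: mass still avoiding y, plus mass already
    absorbed at y.\<close>
  have inv: "(\<integral>\<^sup>+ z. v n z * f z \<partial>count_space E) + (\<Sum>t<n. u t) * f y \<le> f x" for n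
  proof (induction n)
    case 0
    have "(\<integral>\<^sup>+ z. v 0 z * f z \<partial>count_space E) = (\<Sum>z\<in>{x}. v 0 z * f z)"
      using x by (intro nn_integral_count_space') (auto simp: v_def)
    then show ?case by (simp add: v_def B_def)
  next
    case (Suc n)
    have "(\<integral>\<^sup>+ w. v (Suc n) w * f w \<partial>count_space E) + u n * f y
        = (\<integral>\<^sup>+ w. v (Suc n) w * f w \<partial>count_space E) + (\<Sum>w\<in>{y}. u n * f w * indicator {y} w)"
      by simp
    also have "(\<Sum>w\<in>{y}. u n * f w * indicator {y} w) = (\<integral>\<^sup>+ w. u n * f w * indicator {y} w \<partial>count_space E)"
      using y by (intro nn_integral_count_space'[symmetric]) auto
    also have "(\<integral>\<^sup>+ w. v (Suc n) w * f w \<partial>count_space E) + \<dots>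
        = (\<integral>\<^sup>+ w. v (Suc n) w * f w + u n * f w * indicator {y} w \<partial>count_space E)"
      by (intro nn_integral_add[symmetric]) auto
    also have "\<dots> = (\<integral>\<^sup>+ w. (\<integral>\<^sup>+ z. v n z * (k z w * f w) \<partial>count_space E) \<partial>count_space E)"
    proof (rule nn_integral_cong)
      fix w
      \<comment> \<open>One step moves the mass by k; the part landing in y leaves v and is recorded
        as \<open>u n\<close>.\<close>
      have "v (Suc n) w = (if w = y then 0 else \<integral>\<^sup>+ z. v n z * k z w \<partial>count_space E)"
        unfolding v_def path_weight_Suc_Some by (simp add: B_def)
      then show "v (Suc n) w * f w + u n * f w * indicator {y} w = (\<integral>\<^sup>+ z. v n z * (k z w * f w) \<partial>count_space E)"
        by (simp add: u_def nn_integral_multc mult.assoc[symmetric])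
    qed
    also have "\<dots> = (\<integral>\<^sup>+ z. (\<integral>\<^sup>+ w. v n z * (k z w * f w) \<partial>count_space E) \<partial>count_space E)"
      using countable by (intro nn_integral_count_space_nn_integral) auto
    also have "\<dots> = (\<integral>\<^sup>+ z. v n z * kernel_op E k f z \<partial>count_space E)"
      by (simp add: nn_integral_cmult kernel_op_def)
    also have "\<dots> \<le> (\<integral>\<^sup>+ z. v n z * f z \<partial>count_space E)"
      using super by (intro nn_integral_mono mult_left_mono) auto
    finally have "(\<integral>\<^sup>+ w. v (Suc n) w * f w \<partial>count_space E) + u n * f y \<le> (\<integral>\<^sup>+ z. v n z * f z \<partial>count_space E)" .
    then have "(\<integral>\<^sup>+ w. v (Suc n) w * f w \<partial>count_space E) + u n * f y + (\<Sum>t<n. u t) * f y \<le> f x"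
      using Suc.IH by (meson add_right_mono order_trans)
    then show ?case by (simp add: distrib_right add_ac)
  qed
  have "{\<omega> \<in> space (M x). \<exists>t>0. X t \<omega> = Some y} \<subseteq> (\<Union>n. A n)"
  proof
    fix \<omega> assume "\<omega> \<in> {\<omega> \<in> space (M x). \<exists>t>0. X t \<omega> = Some y}"
    then obtain t where \<omega>: "\<omega> \<in> space (M x)" and t: "X (Suc t) \<omega> = Some y"
      by (auto simp: gr0_conv_Suc)
    define n where "n = (LEAST t. X (Suc t) \<omega> = Some y)"
    have "X (Suc n) \<omega> = Some y" unfolding n_def using t by (rule LeastI)
    moreover have "X i \<omega> \<in> B i" if "i \<le> n" for i
      using that not_less_Least[of "i - 1" "\<lambda>t. X (Suc t) \<omega> = Some y"]
      by (cases i) (auto simp: B_def n_def)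
    ultimately show "\<omega> \<in> (\<Union>n. A n)" using \<omega> by (auto simp: A_def)
  qed
  then have "emeasure (M x) {\<omega> \<in> space (M x). \<exists>t>0. X t \<omega> = Some y} \<le> emeasure (M x) (\<Union>n. A n)"
    using A_sets by (intro emeasure_mono) auto
  also have "\<dots> \<le> (\<Sum>n. emeasure (M x) (A n))"
    using A_sets by (intro emeasure_subadditive_countably) auto
  also have "\<dots> = (\<Sum>n. u n)" by (simp only: A_eq)
  finally have "ennreal (hit_prob M X x y) \<le> (\<Sum>n. u n)"
    by (simp add: hit_prob_def px.emeasure_eq_measure)
  then have "ennreal (hit_prob M X x y) * f y \<le> (\<Sum>n. u n * f y)"
    by (simp add: mult_right_mono)
  also have "\<dots> \<le> f x"
    unfolding suminf_eq_SUP
  proof (rule SUP_least)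
    fix n show "(\<Sum>t<n. u t * f y) \<le> f x"
      unfolding sum_distrib_right[symmetric]
      by (rule order_trans[OF _ inv[of n]]) (simp add: add_increasing)
  qed
  finally show ?thesis .
qed

lemma hit_prob_pos:
  assumes irr: "irreducible_chain E M X" and x: "x \<in> E" and y: "y \<in> E"
  shows "0 < hit_prob M X x y"
proof -
  interpret px: prob_space "M x" by (rule prob_space[OF x])
  obtain n where n: "n \<ge> 1" "0 < measure (M x) {\<omega> \<in> space (M x). X n \<omega> = Some y}"
    using irr x y by (auto simp: irreducible_chain_def)
  have "{\<omega> \<in> space (M x). \<exists>t>0. X t \<omega> = Some y} = (\<Union>t\<in>{0<..}. {\<omega> \<in> space (M x). X t \<omega> = Some y})" by auto
  then have m: "{\<omega> \<in> space (M x). \<exists>t>0. X t \<omega> = Some y} \<in> sets (M x)"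
    by (simp only:) (intro sets.countable_UN' image_subsetI sets_X_eq x countableI_type)
  have "measure (M x) {\<omega> \<in> space (M x). X n \<omega> = Some y} \<le> hit_prob M X x y"
    unfolding hit_prob_def
  proof (rule px.finite_measure_mono[OF subsetI m])
    fix \<omega> assume "\<omega> \<in> {\<omega> \<in> space (M x). X n \<omega> = Some y}"
    moreover have "0 < n" using n(1) by simp
    ultimately show "\<omega> \<in> {\<omega> \<in> space (M x). \<exists>t>0. X t \<omega> = Some y}" by blast
  qed
  then show ?thesis using n(2) by simp
qed

lemma kernel_pow_pos:
  assumes irr: "irreducible_chain E M X" and x: "x \<in> E" and y: "y \<in> E"
  obtains n where "0 < (kernel_op E k ^^ n) (indicator {y}) x"
proof -
  interpret px: prob_space "M x" by (rule prob_space[OF x])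
  obtain n where n: "0 < measure (M x) {\<omega> \<in> space (M x). X n \<omega> = Some y}"
    using irr x y by (auto simp: irreducible_chain_def)
  then have "0 < emeasure (M x) {\<omega> \<in> space (M x). X n \<omega> = Some y}"
    by (simp add: px.emeasure_eq_measure)
  then show ?thesis using that emeasure_X_eq[OF x y] by metis
qed

lemma green_eq:
  assumes "x \<in> E" "z \<in> E"
  shows "green M X x z = potential E k (indicator {z}) x"
  using assms by (simp add: green_def potential_def emeasure_X_eq)

end

section \<open>Decomposition of harmonic functions\<close>

text \<open>The elementary Harnack bound at a fixed time, enough wherever only positivity or
  finiteness has to be spread by irreducibility.\<close>

lemma kernel_pow_indicator_le:
  assumes "\<And>z. z \<in> E \<Longrightarrow> kernel_op E k f z \<le> f z" "x \<in> E"
  shows "(kernel_op E k ^^ n) (indicator {y}) x * f y \<le> f x"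
proof -
  have "(kernel_op E k ^^ n) (indicator {y}) x * f y = (kernel_op E k ^^ n) (\<lambda>z. f y * indicator {y} z) x"
    by (simp add: kernel_pow_cmult mult.commute)
  also have "\<dots> \<le> (kernel_op E k ^^ n) f x"
    using assms(2) by (intro kernel_pow_mono) (auto split: split_indicator)
  also have "\<dots> \<le> f x"
    using assms by (rule kernel_pow_le)
  finally show ?thesis .
qed

context semigroup_kernel
begin

text \<open>The limit term of the decomposition; for harmonic f under slow variation the iterates
  decrease, so the infimum is their limit.\<close>

definition residual :: "('a \<Rightarrow> ennreal) \<Rightarrow> 'a \<Rightarrow> ennreal" where
  "residual f x = (INF n. (kernel_op E ladder ^^ n) f x)"

abbreviation "ladder_renewal \<equiv> potential E ladder (\<lambda>_. 1)"

context
  fixes f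
  assumes ce: "countable E" and sv: slowly_varying and f: "harmonic f"
begin

lemma ladder_superharmonic: "x \<in> E \<Longrightarrow> kernel_op E ladder f x \<le> f x"
  using harmonic_ladder[OF ce sv f] by (metis le_iff_add add.commute)

lemma residual_tendsto: "x \<in> E \<Longrightarrow> (\<lambda>n. (kernel_op E ladder ^^ n) f x) \<longlonglongrightarrow> residual f x"
  unfolding residual_def
  by (intro LIMSEQ_INF kernel_pow_decseq) (auto intro: ladder_superharmonic)

text \<open>Unrolls f = f(e) + P_H f; the constant source f(e) factors out of the renewal
  sum.\<close>

lemma harmonic_decomposition:
  assumes x: "x \<in> E"
  shows "f x = f \<one> * ladder_renewal x + residual f x"
proof -
  have "(\<lambda>n. (\<Sum>t<n. (kernel_op E ladder ^^ t) (\<lambda>_. f \<one> * 1) x) + (kernel_op E ladder ^^ n) f x)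
      \<longlonglongrightarrow> potential E ladder (\<lambda>_. f \<one> * 1) x + residual f x"
    by (intro tendsto_add LIMSEQ_potential residual_tendsto x)
  moreover have "(\<Sum>t<n. (kernel_op E ladder ^^ t) (\<lambda>_. f \<one> * 1) x) + (kernel_op E ladder ^^ n) f x = f x" for n
    by (rule kernel_iterate[symmetric, OF _ x]) (simp, rule harmonic_ladder[OF ce sv f])
  ultimately show ?thesis by (simp add: LIMSEQ_const_iff potential_cmult del: mult_1_right)
qed

lemma ladder_residual:
  assumes x: "x \<in> E"
  shows "kernel_op E ladder (residual f) x = residual f x"
proof -
  let ?L = "kernel_op E ladder"
  have dec: "decseq (\<lambda>n. (?L ^^ n) f y)" if "y \<in> E" for y
    using ladder_superharmonic that by (rule kernel_pow_decseq)
  have "?L (residual f) x = (INF n. ?L ((?L ^^ n) f) x)"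
    unfolding residual_def[abs_def]
  proof (rule kernel_op_INF)
    show "(?L ^^ Suc n) f y \<le> (?L ^^ n) f y" if "y \<in> E" for n y
      using dec[OF that] by (rule decseq_SucD)
    show "?L ((?L ^^ 0) f) x < \<infinity>"
      using le_less_trans[OF ladder_superharmonic[OF x] harmonicD(2)[OF f x]] by simp
  qed
  moreover have "(\<lambda>n. ?L ((?L ^^ n) f) x) \<longlonglongrightarrow> (INF n. ?L ((?L ^^ n) f) x)"
  proof -
    have "decseq (\<lambda>n. (?L ^^ Suc n) f x)"
      using dec[OF x] unfolding decseq_def by (blast intro: Suc_le_mono[THEN iffD2])
    then show ?thesis using LIMSEQ_INF by fastforce
  qed
  moreover have "(\<lambda>n. ?L ((?L ^^ n) f) x) \<longlonglongrightarrow> residual f x"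
    using LIMSEQ_Suc[OF residual_tendsto[OF x]] by simp
  ultimately show ?thesis by (metis LIMSEQ_unique)
qed

context
  assumes irr: "\<And>x y. x \<in> E \<Longrightarrow> y \<in> E \<Longrightarrow> \<exists>n. 0 < (P ^^ n) (indicator {y}) x"
    and nz: "\<exists>x\<in>E. f x \<noteq> 0"
begin

lemma harmonic_one_pos: "0 < f \<one>"
proof -
  obtain y where y: "y \<in> E" "f y \<noteq> 0" using nz by blast
  obtain n where n: "0 < (P ^^ n) (indicator {y}) \<one>" using irr[OF E_one y(1)] by blast
  have "0 < (P ^^ n) (indicator {y}) \<one> * f y"
    using n y by (simp add: ennreal_zero_less_mult_iff zero_less_iff_neq_zero)
  also have "\<dots> \<le> f \<one>"
    using harmonicD(1)[OF f] by (intro kernel_pow_indicator_le) auto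
  finally show ?thesis .
qed

text \<open>In the decomposition of the finite f, the renewal function carries the positive factor
  f(e).\<close>

lemma ladder_renewal_finite:
  assumes x: "x \<in> E"
  shows "ladder_renewal x < \<infinity>"
proof (rule ccontr)
  assume "\<not> ladder_renewal x < \<infinity>"
  then have "ladder_renewal x = \<infinity>" by (simp add: not_less top_unique)
  then have "f x = \<infinity>"
    using harmonic_decomposition[OF x] harmonic_one_pos by (auto simp: ennreal_mult_top)
  then show False using harmonicD(2)[OF f x] by simp
qed

text \<open>At e the decomposition reads f(e) = f(e) W(e) + residual, and W(e) >= 1 leaves no room
  for the residual.\<close>

lemma residual_one: "residual f \<one> = 0"
proof -
  have "f \<one> * 1 \<le> f \<one> * ladder_renewal \<one>"
    by (intro mult_left_mono potential_one_ge) auto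
  then have "f \<one> + residual f \<one> \<le> f \<one> + 0"
    using harmonic_decomposition[OF E_one] by (metis add.right_neutral add_right_mono mult_1_right)
  then show ?thesis
    using harmonicD(2)[OF f E_one] by (auto simp: ennreal_add_left_cancel_le)
qed

text \<open>Subtracting the subharmonic f(e) W from the harmonic f leaves a superharmonic residual.
  It vanishes at e, hence everywhere by irreducibility.\<close>

lemma residual_eq_0:
  assumes inf: "potential E k (\<lambda>_. 1) \<one> = \<infinity>" and x: "x \<in> E"
  shows "residual f x = 0"
proof -
  have super: "P (residual f) y \<le> residual f y" if y: "y \<in> E" for y
  proof -
    have fW: "f \<one> * ladder_renewal y < \<infinity>"
      using ladder_renewal_finite[OF y] harmonicD(2)[OF f E_one] by (simp add: ennreal_mult_less_top)
    have "f \<one> * ladder_renewal y + P (residual f) y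
        \<le> f \<one> * P ladder_renewal y + P (residual f) y"
      using ladder_potential_subharmonic[OF ce ladder_renewal_finite inf y]
      by (intro add_right_mono mult_left_mono) auto
    also have "\<dots> = P (\<lambda>z. f \<one> * ladder_renewal z + residual f z) y"
      by (simp add: kernel_op_add kernel_op_cmult)
    also have "\<dots> = P f y"
      by (rule kernel_op_cong) (simp_all flip: harmonic_decomposition)
    also have "\<dots> = f \<one> * ladder_renewal y + residual f y"
      using harmonicD(1)[OF f y] harmonic_decomposition[OF y] by simp
    finally show ?thesis
      using fW by (auto simp: ennreal_add_left_cancel_le)
  qed
  obtain n where n: "0 < (P ^^ n) (indicator {x}) \<one>" using irr[OF E_one x] by blast
  have "(P ^^ n) (indicator {x}) \<one> * residual f x \<le> residual f \<one>"
    using super by (rule kernel_pow_indicator_le) auto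
  then show ?thesis using n by (auto simp: residual_one)
qed

text \<open>Otherwise f = f(e) W, and G 1(e) W <= G 1 makes f at most a multiple of a finite
  potential. Applying P^n fixes f and sends the potential to 0, contradicting f > 0.\<close>

lemma residual_nonzero:
  assumes x: "x \<in> E" and fin: "potential E k (\<lambda>_. 1) x < \<infinity>"
  shows "\<exists>y\<in>E. residual f y \<noteq> 0"
proof (rule ccontr)
  let ?g = "potential E k (\<lambda>_. 1)"
  assume "\<not> (\<exists>y\<in>E. residual f y \<noteq> 0)"
  then have eq: "f y = f \<one> * ladder_renewal y" if "y \<in> E" for y
    using harmonic_decomposition[OF that] that by simp
  \<comment> \<open>Finiteness is assumed at the single point x and spreads by irreducibility, as
    \<open>?g\<close> is superharmonic.\<close>
  have gfin: "?g y < \<infinity>" if y: "y \<in> E" for y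
  proof -
    obtain n where n: "0 < (P ^^ n) (indicator {y}) x" using irr[OF x y] by blast
    have "(P ^^ n) (indicator {y}) x * ?g y \<le> ?g x"
      by (rule kernel_pow_indicator_le[OF _ x]) (metis le_iff_add add.commute potential_eq)
    then have "(P ^^ n) (indicator {y}) x * ?g y < \<infinity>" using fin by (rule le_less_trans)
    then show ?thesis using n by (auto simp: ennreal_mult_less_top)
  qed
  have le: "?g \<one> * f y \<le> f \<one> * ?g y" if y: "y \<in> E" for y
  proof -
    have "potential E ladder (\<lambda>_. ?g \<one> * 1) y \<le> ?g y"
      unfolding mult_1_right
      by (rule potential_le[OF eq_refl[OF potential_one_ladder[OF ce gfin, symmetric]] y])
    then have "?g \<one> * ladder_renewal y \<le> ?g y"
      by (simp only: potential_cmult)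
    then have "f \<one> * (?g \<one> * ladder_renewal y) \<le> f \<one> * ?g y" by (rule mult_left_mono) simp
    then show ?thesis using eq[OF y] by (simp add: mult.left_commute)
  qed
  have "?g \<one> * f x \<le> f \<one> * (P ^^ n) ?g x" for n
  proof -
    have "?g \<one> * f x = (P ^^ n) (\<lambda>y. ?g \<one> * f y) x"
      using kernel_pow_harmonic[OF harmonicD(1)[OF f] x, of n] by (simp add: kernel_pow_cmult)
    also have "\<dots> \<le> (P ^^ n) (\<lambda>y. f \<one> * ?g y) x"
      using le x by (rule kernel_pow_mono)
    finally show ?thesis by (simp add: kernel_pow_cmult)
  qed
  moreover have "(\<lambda>n. f \<one> * (P ^^ n) ?g x) \<longlonglongrightarrow> f \<one> * 0"
    using harmonicD(2)[OF f E_one] fin by (intro ennreal_tendsto_cmult kernel_pow_potential_tendsto_0) auto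
  ultimately have "?g \<one> * f x \<le> f \<one> * 0" by (intro LIMSEQ_le_const) auto
  moreover have "?g \<one> \<noteq> 0" using potential_one_ge[of k \<one>] by auto
  ultimately have "f x = 0" by simp
  then have "f \<one> * ladder_renewal x = 0" using eq[OF x] by simp
  then show False using harmonic_one_pos potential_one_ge[of ladder x] by auto
qed

end

end

text \<open>The Harnack inequality in both directions between x and x u^n turns the two limits into
  the two bounds.\<close>

lemma slowly_varying_if_hitting:
  assumes ch: "chain E k M X" and irr: "irreducible_chain E M X" and sv: "slowly_varying_hitting G E M X"
  shows slowly_varying
  unfolding slowly_varying_def
proof (intro ballI allI impI)
  interpret chain E k M X by (rule ch)
  fix u and \<epsilon> :: real assume u: "u \<in> E" and \<epsilon>: "0 < \<epsilon>"
  let ?Q = "hit_prob M X"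
  have "\<forall>\<^sub>F n in sequentially. \<forall>x\<in>E. dist (ln (?Q x (x \<otimes> u [^] n)) / real n) 0 < \<epsilon>"
    "\<forall>\<^sub>F n in sequentially. \<forall>x\<in>E. dist (ln (?Q (x \<otimes> u [^] n) x) / real n) 0 < \<epsilon>"
    using uniform_limitD[OF _ \<epsilon>] sv u unfolding slowly_varying_hitting_def by blast+
  \<comment> \<open>The condition 0 < n is recorded because n = 0 would make the quotient 0 and the
    bound on it empty.\<close>
  then have "\<forall>\<^sub>F n in sequentially. (\<forall>x\<in>E. \<bar>ln (?Q x (x \<otimes> u [^] n)) / real n\<bar> < \<epsilon>) \<and>
      (\<forall>x\<in>E. \<bar>ln (?Q (x \<otimes> u [^] n) x) / real n\<bar> < \<epsilon>) \<and> 0 < n"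
    using eventually_gt_at_top[of 0] by eventually_elim (simp add: dist_real_def)
  then obtain N where N: "\<And>n. N \<le> n \<Longrightarrow> (\<forall>x\<in>E. \<bar>ln (?Q x (x \<otimes> u [^] n)) / real n\<bar> < \<epsilon>) \<and>
      (\<forall>x\<in>E. \<bar>ln (?Q (x \<otimes> u [^] n) x) / real n\<bar> < \<epsilon>) \<and> 0 < n"
    unfolding eventually_sequentially by blast
  have harnack: "f y \<le> ennreal (exp (\<epsilon> * real n)) * f x"
    if f: "harmonic f" and xy: "x \<in> E" "y \<in> E" and n: "0 < n" and Q: "\<bar>ln (?Q x y) / real n\<bar> < \<epsilon>" for f x y n
  proof -
    have "- (\<epsilon> * real n) \<le> ln (?Q x y)"
      using Q n by (simp add: abs_less_iff field_simps)
    \<comment> \<open>Irreducibility makes the hitting probability positive, so \<open>exp\<close>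
      undoes \<open>ln\<close>.\<close>
    then have "exp (- (\<epsilon> * real n)) \<le> ?Q x y"
      using hit_prob_pos[OF irr xy] by (metis exp_le_cancel_iff exp_ln)
    then have "ennreal (exp (- (\<epsilon> * real n))) * f y \<le> ennreal (?Q x y) * f y"
      by (intro mult_right_mono ennreal_leI) auto
    also have "\<dots> \<le> f x"
      using harmonicD(1)[OF f] xy by (intro hit_prob_mult_le) auto
    finally have "ennreal (exp (\<epsilon> * real n)) * (ennreal (exp (- (\<epsilon> * real n))) * f y) \<le> ennreal (exp (\<epsilon> * real n)) * f x"
      by (rule mult_left_mono) simp
    moreover have "ennreal (exp (\<epsilon> * real n)) * ennreal (exp (- (\<epsilon> * real n))) = 1"
      by (simp add: exp_minus flip: ennreal_mult)
    ultimately show ?thesis by (simp add: mult.assoc[symmetric])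
  qed
  show "\<exists>N. \<forall>n\<ge>N. \<forall>f x. harmonic f \<longrightarrow> x \<in> E \<longrightarrow>
     f (x \<otimes> u [^] n) \<le> ennreal (exp (\<epsilon> * real n)) * f x \<and>
     f x \<le> ennreal (exp (\<epsilon> * real n)) * f (x \<otimes> u [^] n)"
  proof (intro exI[of _ N] allI impI)
    fix n f x assume n: "N \<le> n" and f: "harmonic f" and x: "x \<in> E"
    have y: "x \<otimes> u [^] n \<in> E" using x u by auto
    show "f (x \<otimes> u [^] n) \<le> ennreal (exp (\<epsilon> * real n)) * f x \<and>
     f x \<le> ennreal (exp (\<epsilon> * real n)) * f (x \<otimes> u [^] n)"
      using N[OF n] x harnack[OF f x y, of n] harnack[OF f y x, of n] by blast
  qed
qed

end

theorem theorem3: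
  fixes G :: "('a, 'b) monoid_scheme" and E :: "'a set" and p :: "'a \<Rightarrow> 'a \<Rightarrow> real"
    and M :: "'a \<Rightarrow> 'w measure" and X :: "nat \<Rightarrow> 'w \<Rightarrow> 'a option"
    and N :: "'a \<Rightarrow> 'v measure" and H :: "nat \<Rightarrow> 'v \<Rightarrow> 'a option"
  defines "P\<^sub>H \<equiv> kernel_op E (ladder_kernel G E p M X)"
    and "V \<equiv> expected_killing_time 0 N H"
    and "h_tilde \<equiv> surviving_limit N H"
  assumes "group G" and "submonoid E G" and "countable E"
    and "substochastic E p"
    and "\<forall>x\<in>E. \<forall>y\<in>E. \<forall>u\<in>E. p (x \<otimes>\<^bsub>G\<^esub> u) (y \<otimes>\<^bsub>G\<^esub> u) \<ge> p x y"
    and "markov_chain E (\<lambda>x y. ennreal (p x y)) M X"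
    and "irreducible_chain E M X" and "transient_chain E M X"
    and "slowly_varying_hitting G E M X"
    and "markov_chain E (ladder_kernel G E p M X) N H"
  shows "(\<forall>h. harmonic_function E p h \<longrightarrow>
            (\<forall>x\<in>E. P\<^sub>H (\<lambda>y. ennreal (h y)) x \<le> ennreal (h x)) \<and>
            (\<forall>x\<in>E. surviving_mean N H h x \<longlonglongrightarrow> h_tilde h x) \<and>
            (\<forall>x\<in>E. ennreal (h x) = ennreal (h \<one>\<^bsub>G\<^esub>) * V x + h_tilde h x) \<and>
            (\<forall>x\<in>E. P\<^sub>H (h_tilde h) x = h_tilde h x)) \<and>
         (if \<forall>x\<in>E. expected_killing_time 1 M X x = \<infinity>
          then \<forall>h. harmonic_function E p h \<longrightarrow>
                 (\<forall>x\<in>E. h_tilde h x = 0) \<and>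
                 (\<exists>c>0. \<forall>x\<in>E. ennreal (h x) = ennreal c * V x)
          else \<forall>h. harmonic_function E p h \<longrightarrow> (\<exists>x\<in>E. h_tilde h x \<noteq> 0))"
proof -
  interpret group G by fact
  interpret semigroup_kernel G E p
    using assms(4,5,7,8) by (intro semigroup_kernel.intro semigroup_kernel_axioms.intro) auto
  interpret X: chain E k M X
    using assms(6,9) by unfold_locales auto
  interpret H: chain E "ladder_kernel G E p M X" N H
    using assms(6,13) by unfold_locales auto
  have sv: slowly_varying
    using X.chain_axioms assms(10,12) by (rule slowly_varying_if_hitting)
  have irr: "\<exists>n. 0 < (P ^^ n) (indicator {y}) x" if "x \<in> E" "y \<in> E" for x y
    using X.kernel_pow_pos[OF assms(10) that] by blast
  have kernel: "ladder_kernel G E p M X x y = ladder x y" for x y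
    unfolding ladder_kernel_def ladder_def
    by (intro nn_integral_cong) (simp add: X.green_eq)
  \<comment> \<open>From here the process H is governed by \<open>ladder\<close>, and all results of
    the locale apply to it.\<close>
  have kernel': "ladder_kernel G E p M X = ladder"
    by (intro ext kernel)
  have PH: "P\<^sub>H = kernel_op E ladder"
    by (simp add: P\<^sub>H_def kernel')
  have V: "V x = ladder_renewal x" if "x \<in> E" for x
    using H.expected_killing_time_eq[OF that, of 0] by (simp add: V_def kernel')
  have \<tau>: "expected_killing_time 1 M X x = potential E k (\<lambda>_. 1) x" if "x \<in> E" for x
    using X.expected_killing_time_eq[OF that, of 1] by simp
  have main: "harmonic (\<lambda>y. ennreal (h y))" "\<exists>x\<in>E. ennreal (h x) \<noteq> 0"
    "\<And>x. x \<in> E \<Longrightarrow> surviving_mean N H h x \<longlonglongrightarrow> residual (\<lambda>y. ennreal (h y)) x"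
    "\<And>x. x \<in> E \<Longrightarrow> h_tilde h x = residual (\<lambda>y. ennreal (h y)) x"
    if h: "harmonic_function E p h" for h
  proof -
    show hh: "harmonic (\<lambda>y. ennreal (h y))"
      using h by (auto simp: harmonic_function_def harmonic_def)
    show "\<exists>x\<in>E. ennreal (h x) \<noteq> 0"
      using h unfolding harmonic_function_def by (metis ennreal_eq_0_iff order_antisym)
    show lim: "surviving_mean N H h x \<longlonglongrightarrow> residual (\<lambda>y. ennreal (h y)) x" if "x \<in> E" for x
      using residual_tendsto[OF assms(6) sv hh that] H.surviving_mean_eq[OF that, of h, abs_def]
      by (simp add: kernel')
    show "h_tilde h x = residual (\<lambda>y. ennreal (h y)) x" if "x \<in> E" for x
      using limI[OF lim[OF that]] by (simp add: h_tilde_def surviving_limit_def)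
  qed
  have 1: "(\<forall>x\<in>E. P\<^sub>H (\<lambda>y. ennreal (h y)) x \<le> ennreal (h x)) \<and>
      (\<forall>x\<in>E. surviving_mean N H h x \<longlonglongrightarrow> h_tilde h x) \<and>
      (\<forall>x\<in>E. ennreal (h x) = ennreal (h \<one>\<^bsub>G\<^esub>) * V x + h_tilde h x) \<and>
      (\<forall>x\<in>E. P\<^sub>H (h_tilde h) x = h_tilde h x)"
    if h: "harmonic_function E p h" for h
  proof (intro conjI ballI)
    note hh = assms(6) sv main(1)[OF h]
    fix x assume x: "x \<in> E"
    show "P\<^sub>H (\<lambda>y. ennreal (h y)) x \<le> ennreal (h x)"
      unfolding PH using hh x by (rule ladder_superharmonic)
    show "surviving_mean N H h x \<longlonglongrightarrow> h_tilde h x"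
      using main(3,4)[OF h x] by simp
    show "ennreal (h x) = ennreal (h \<one>\<^bsub>G\<^esub>) * V x + h_tilde h x"
      using harmonic_decomposition[OF hh x] V[OF x] main(4)[OF h x] by simp
    have "P\<^sub>H (h_tilde h) x = P\<^sub>H (residual (\<lambda>y. ennreal (h y))) x"
      unfolding PH using main(4)[OF h] by (rule kernel_op_cong) simp_all
    then show "P\<^sub>H (h_tilde h) x = h_tilde h x"
      using ladder_residual[OF hh x] main(4)[OF h x] by (simp add: PH)
  qed
  have 2: "(\<forall>x\<in>E. h_tilde h x = 0) \<and> (\<exists>c>0. \<forall>x\<in>E. ennreal (h x) = ennreal c * V x)"
    if inf: "\<forall>x\<in>E. expected_killing_time 1 M X x = \<infinity>" and h: "harmonic_function E p h" for h
  proof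
    note hh = assms(6) sv main(1)[OF h] irr main(2)[OF h]
    have "potential E k (\<lambda>_. 1) \<one>\<^bsub>G\<^esub> = \<infinity>" using inf \<tau>[OF E_one] by simp
    then show 0: "\<forall>x\<in>E. h_tilde h x = 0"
      using residual_eq_0[OF hh] main(4)[OF h] by simp
    \<comment> \<open>The proportionality factor is h(e).\<close>
    have "0 < h \<one>\<^bsub>G\<^esub>" using harmonic_one_pos[OF hh] by (simp add: ennreal_less_zero_iff)
    moreover have "\<forall>x\<in>E. ennreal (h x) = ennreal (h \<one>\<^bsub>G\<^esub>) * V x"
    proof
      fix x assume x: "x \<in> E"
      then have "ennreal (h x) = ennreal (h \<one>\<^bsub>G\<^esub>) * V x + h_tilde h x" using 1[OF h] by blast
      also have "h_tilde h x = 0" using 0 x by blast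
      finally show "ennreal (h x) = ennreal (h \<one>\<^bsub>G\<^esub>) * V x" by (simp only: add_0_right)
    qed
    ultimately show "\<exists>c>0. \<forall>x\<in>E. ennreal (h x) = ennreal c * V x" by blast
  qed
  have 3: "\<exists>x\<in>E. h_tilde h x \<noteq> 0"
    if fin: "\<not> (\<forall>x\<in>E. expected_killing_time 1 M X x = \<infinity>)" and h: "harmonic_function E p h" for h
  proof -
    note hh = assms(6) sv main(1)[OF h] irr main(2)[OF h]
    obtain x where x: "x \<in> E" "potential E k (\<lambda>_. 1) x < \<infinity>"
      using fin \<tau> by (auto simp: less_top)
    show ?thesis using residual_nonzero[OF hh x] main(4)[OF h] by auto
  qed
  show ?thesis unfolding if_bool_eq_conj using 1 2 3 by blast
qed

end
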